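(* Let $n\ge 1$ be an integer, $0<s<1$, $Q=Q_2(0,0)$ and $\tilde Q=Q_1(0,0)$. There exists a positive constant $C$, independent of $f$, such that the following holds. Let $f$ be bounded in $Q$, let $f_Q=f$ on $Q$ and $f_Q=0$ on $Q^c$, and let $$w(x,t)=\int_{-\infty}^t\int_{\mathbb{R}^n} f_Q(y,\tau)\,G(x-y,t-\tau)\,dy\,d\tau .$$ Then $$\|w\|_{C^{2s,s}_{x,t}(\tilde Q)}\le C\|f\|_{L^\infty(Q)}\quad\text{if } s\ne\tfrac12,$$ $$\|w\|_{C^{\log L,s}_{x,t}(\tilde Q)}\le C\|f\|_{L^\infty(Q)}\quad\text{if } s=\tfrac12.$$
   Context: $Q_r(x^o,t_o)=\{(x,t)\in\mathbb{R}^n\times\mathbb{R}: |x-x^o|<r,\ |t-t_o|<r^2\}$. $G(x,t)=\dfrac{C_{n,s}}{t^{n/2+1-s}}e^{-\frac{|x|^2}{4t}}$ for $t>0$, with $C_{n,s}=\frac{1}{(4\pi)^{n/2}|\Gamma(-s)|}$. The function $f$ is a real-valued measurable function. Parabolic Hölder spaces on a cylinder $\Omega$: (i) if $0<\beta\le\frac12$, $u\in C^{2\beta,\beta}_{x,t}(\Omega)$ means $u$ is bounded and $|u(x,t)-u(y,\tau)|\le K(|x-y|+|t-\tau|^{1/2})^{2\beta}$ on $\Omega$ for some $K$; the norm is $\sup|u|$ plus the least $K$. (ii) If $\frac12<\beta\le 1$, $u\in C^{2\beta,\beta}_{x,t}(\Omega)$ means $u$ and $\nabla_x u$ are bounded,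 $u$ is $\beta$-Hölder in $t$ uniformly in $x$, and $\nabla_x u$ is $(2\beta-1)$-Hölder in $x$ uniformly in $t$ and $(\beta-\frac12)$-Hölder in $t$ uniformly in $x$; the norm is the sum of the corresponding sup norms and Hölder seminorms. Log-Lipschitz space: $\|g\|_{C^{\log L}(D)}=\|g\|_{L^\infty(D)}+\sup_{x\ne y\in D}\dfrac{|g(x)-g(y)|}{|x-y|\,|\log\min\{|x-y|,1/2\}|}$. $C^{\log L,s}_{x,t}(\Omega)$: $u$ is $C^{\log L}$ in $x$ uniformly in $t$ and $C^s$ in $t$ uniformly in $x$, with the corresponding norm. *)

theory Defs
  imports "HOL-Probability.Essential_Supremum" "HOL-Analysis.Gamma_Function"
begin

section \<open>Parabolic cylinders and the kernel of the fractional heat operator\<close>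

definition par_cylinder :: "real \<Rightarrow> real ^ 'n \<Rightarrow> real \<Rightarrow> ((real ^ 'n) \<times> real) set" where
  "par_cylinder r x0 t0 = {(x, t). norm (x - x0) < r \<and> \<bar>t - t0\<bar> < r\<^sup>2}"

text \<open>The kernel is meaningful only for \<open>t > 0\<close>; no other value of \<open>t\<close> is ever used.\<close>

definition kernel_const :: "'n::finite itself \<Rightarrow> real \<Rightarrow> real" where
  "kernel_const _ s = 1 / ((4 * pi) powr (real CARD('n) / 2) * \<bar>Gamma (- s)\<bar>)"

definition frac_heat_kernel :: "real \<Rightarrow> real ^ 'n \<Rightarrow> real \<Rightarrow> real" where
  "frac_heat_kernel s x t =
     kernel_const TYPE('n) s / t powr (real CARD('n) / 2 + 1 - s) * exp (- ((norm x)\<^sup>2 / (4 * t)))"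

definition frac_heat_potential ::
  "real \<Rightarrow> ((real ^ 'n) \<times> real \<Rightarrow> real) \<Rightarrow> (real ^ 'n) \<times> real \<Rightarrow> real" where
  "frac_heat_potential s g = (\<lambda>(x, t).
     LINT \<tau>:{..<t}|lebesgue. (LINT y|lebesgue. g (y, \<tau>) * frac_heat_kernel s (x - y) (t - \<tau>)))"

definition zero_extension :: "'a set \<Rightarrow> ('a \<Rightarrow> real) \<Rightarrow> 'a \<Rightarrow> real" where
  "zero_extension S f p = (if p \<in> S then f p else 0)"


section \<open>Norms\<close>

text \<open>All norms below take values in \<^typ>\<open>ennreal\<close>; a function belongs to the corresponding
  space iff its norm is finite. In particular an infimum over an empty set of constants is
  \<open>\<infinity>\<close>, so a finite bound on a norm contains the membership in the space.\<close>

definition Linfty_norm :: "'a::euclidean_space set \<Rightarrow> ('a \<Rightarrow> real) \<Rightarrow> ennreal" where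
  "Linfty_norm S f = esssup (lebesgue_on S) (\<lambda>p. ennreal \<bar>f p\<bar>)"

definition sup_norm :: "'a set \<Rightarrow> ('a \<Rightarrow> 'b::real_normed_vector) \<Rightarrow> ennreal" where
  "sup_norm S u = (SUP p\<in>S. ennreal (norm (u p)))"

definition holder_seminorm ::
  "real \<Rightarrow> 'a::metric_space set \<Rightarrow> ('a \<Rightarrow> 'b::real_normed_vector) \<Rightarrow> ennreal" where
  "holder_seminorm \<alpha> D g =
     (INF K\<in>{K. 0 \<le> K \<and> (\<forall>x\<in>D. \<forall>y\<in>D. norm (g x - g y) \<le> K * dist x y powr \<alpha>)}. ennreal K)"

definition log_lipschitz_seminorm ::
  "'a::real_normed_vector set \<Rightarrow> ('a \<Rightarrow> real) \<Rightarrow> ennreal" where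
  "log_lipschitz_seminorm D g =
     (SUP (x, y)\<in>{(x, y). x \<in> D \<and> y \<in> D \<and> x \<noteq> y}.
        ennreal (\<bar>g x - g y\<bar> / (norm (x - y) * \<bar>ln (min (norm (x - y)) (1/2))\<bar>)))"

text \<open>Seminorms in one variable, uniformly in the other: the supremum over all slices of
  \<open>\<Omega>\<close> (an empty slice contributes \<open>0\<close>).\<close>

definition holder_seminorm_space ::
  "real \<Rightarrow> ('a::metric_space \<times> real) set \<Rightarrow> ('a \<times> real \<Rightarrow> 'b::real_normed_vector) \<Rightarrow> ennreal" where
  "holder_seminorm_space \<alpha> \<Omega> u = (SUP t. holder_seminorm \<alpha> {x. (x, t) \<in> \<Omega>} (\<lambda>x. u (x, t)))"

definition holder_seminorm_time ::
  "real \<Rightarrow> ('a \<times> real) set \<Rightarrow> ('a \<times> real \<Rightarrow> 'b::real_normed_vector) \<Rightarrow> ennreal" where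
  "holder_seminorm_time \<alpha> \<Omega> u = (SUP x. holder_seminorm \<alpha> {t. (x, t) \<in> \<Omega>} (\<lambda>t. u (x, t)))"

definition log_lipschitz_seminorm_space ::
  "('a::real_normed_vector \<times> real) set \<Rightarrow> ('a \<times> real \<Rightarrow> real) \<Rightarrow> ennreal" where
  "log_lipschitz_seminorm_space \<Omega> u =
     (SUP t. log_lipschitz_seminorm {x. (x, t) \<in> \<Omega>} (\<lambda>x. u (x, t)))"

definition par_holder_seminorm ::
  "real \<Rightarrow> ('a::real_normed_vector \<times> real) set \<Rightarrow> ('a \<times> real \<Rightarrow> real) \<Rightarrow> ennreal" where
  "par_holder_seminorm \<beta> \<Omega> u =
     (INF K\<in>{K. 0 \<le> K \<and> (\<forall>(x, t)\<in>\<Omega>. \<forall>(y, \<tau>)\<in>\<Omega>.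
          \<bar>u (x, t) - u (y, \<tau>)\<bar> \<le> K * (norm (x - y) + sqrt \<bar>t - \<tau>\<bar>) powr (2 * \<beta>))}. ennreal K)"

definition grad_x :: "('a::real_inner \<times> real \<Rightarrow> real) \<Rightarrow> 'a \<times> real \<Rightarrow> 'a" where
  "grad_x u = (\<lambda>(x, t). THE D. GDERIV (\<lambda>y. u (y, t)) x :> D)"

text \<open>The norm of \<open>C\<^sup>2\<^sup>\<beta>\<^sup>,\<^sup>\<beta>\<close> for \<open>0 < \<beta> \<le> 1\<close>; for \<open>\<beta> > 1/2\<close> it is infinite
  unless the spatial gradient exists everywhere on \<open>\<Omega>\<close>.\<close>

definition par_holder_norm ::
  "real \<Rightarrow> ('a::real_inner \<times> real) set \<Rightarrow> ('a \<times> real \<Rightarrow> real) \<Rightarrow> ennreal" where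
  "par_holder_norm \<beta> \<Omega> u =
     (if \<beta> \<le> 1/2 then sup_norm \<Omega> u + par_holder_seminorm \<beta> \<Omega> u
      else if \<forall>(x, t)\<in>\<Omega>. \<exists>D. GDERIV (\<lambda>y. u (y, t)) x :> D then
        sup_norm \<Omega> u + sup_norm \<Omega> (grad_x u)
        + holder_seminorm_time \<beta> \<Omega> u
        + holder_seminorm_space (2 * \<beta> - 1) \<Omega> (grad_x u)
        + holder_seminorm_time (\<beta> - 1/2) \<Omega> (grad_x u)
      else \<infinity>)"

text \<open>Functions of finite norm are continuous, so on an open set the pointwise supremum
  is the \<open>L\<^sup>\<infinity>\<close> norm.\<close>

definition log_lipschitz_holder_norm ::
  "real \<Rightarrow> ('a::real_normed_vector \<times> real) set \<Rightarrow> ('a \<times> real \<Rightarrow> real) \<Rightarrow> ennreal" where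
  "log_lipschitz_holder_norm s \<Omega> u =
     sup_norm \<Omega> u + log_lipschitz_seminorm_space \<Omega> u + holder_seminorm_time s \<Omega> u"

end

theory Submission
  imports Defs "HOL-Probability.Distributions"
begin

text \<open>
  Up to a constant the kernel is self-similar, \<open>k(z, h) = h\<^sup>\<alpha> \<phi>(z / \<surd>h)\<close> with \<open>\<phi>\<close> Gaussian, so that
  \<open>\<integral> \<bar>k(z, h)\<bar> dz\<close> is a multiple of \<open>h\<^sup>a\<close> with \<open>a = s - 1\<close>. Shifting \<open>z\<close> by \<open>e\<close> gains a factor
  \<open>min 1 (\<bar>e\<bar> / \<surd>h)\<close> in this integral, and replacing \<open>h\<close> by \<open>h + d\<close> gains \<open>min 1 (d / h)\<close>.
  Integrating these bounds over \<open>h\<close> gives the powers \<open>\<bar>e\<bar>\<close> to the \<open>2(a + 1)\<close>, provided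
  \<open>a < -1/2\<close>, and \<open>d\<close> to the \<open>a + 1\<close>; for \<open>a = -1/2\<close> the first integral diverges
  logarithmically at infinity, and the bounded time interval leaves a factor \<open>\<bar>log \<bar>e\<bar>\<bar>\<close>.
  The spatial gradient of the kernel is of the same type with \<open>a = s - 3/2\<close>, which is admissible
  exactly when \<open>s > 1/2\<close>; a first-order Taylor bound shows that its potential is the
  gradient of the potential.
\<close>

section \<open>Gaussian and power integrals\<close>

text \<open>The gains of the form \<open>min 1 ...\<close> change regime at the parabolic scale,
  \<open>h = |e|^2\<close> for a shift and \<open>h = d\<close> for a time step. Above it the mean
  value theorem is applied to the rescaled profile; below it the triangle inequality suffices,
  because \<open>a > -1\<close> makes \<open>h^a\<close> integrable at 0. At infinity the gain has
  to beat \<open>h^a\<close>: it decays like \<open>h^(-1/2)\<close> for a shift and like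
  \<open>h^(-1)\<close> for a time step, so the two differences do not have the same admissible
  range of \<open>a\<close>. Kernel and gradient go through one set of estimates, which asks of a
  profile only Gaussian decay and Lipschitz bounds under translation and dilation; the profile may
  be scalar or vector valued. A second obstacle is measure theoretic. \<open>f\<close> is only
  Lebesgue measurable, so its slices need not be measurable at every time, while the potential is an
  iterated integral. A Borel function that agrees with the extension of \<open>f\<close> almost
  everywhere and is bounded everywhere by the essential supremum takes its place before any
  estimate, and Fubini turns the iterated integral into one over space-time.\<close>

lemma nn_integral_gaussian_real:
  fixes c :: real
  assumes "c > 0"
  shows "(\<integral>\<^sup>+x. ennreal (exp (- (c * x\<^sup>2))) \<partial>lborel) = ennreal (sqrt (pi / c))"
proof -
  define d where "d = sqrt c"
  have d: "d > 0" "d\<^sup>2 = c" using assms by (auto simp: d_def)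
  have "has_bochner_integral lborel (\<lambda>x::real. exp (- x\<^sup>2)) (2 *\<^sub>R (sqrt pi / 2))"
    by (rule has_bochner_integral_even_function[OF gaussian_moment_0]) simp
  then have 1: "(\<integral>\<^sup>+(x::real). ennreal (exp (- x\<^sup>2)) \<partial>lborel) = ennreal (sqrt pi)"
    by (subst nn_integral_eq_integral) (auto simp: has_bochner_integral_iff)
  have "(\<integral>\<^sup>+(x::real). ennreal (exp (- x\<^sup>2)) \<partial>lborel) =
      ennreal d * (\<integral>\<^sup>+x. ennreal (exp (- (c * x\<^sup>2))) \<partial>lborel)"
    using nn_integral_real_affine[of "\<lambda>x::real. ennreal (exp (- x\<^sup>2))" d 0] d
    by (simp add: power_mult_distrib)
  then have "ennreal (1/d) * ennreal (sqrt pi) = ennreal (1/d) * (ennreal d * (\<integral>\<^sup>+x. ennreal (exp (- (c * x\<^sup>2))) \<partial>lborel))"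
    using 1 by simp
  also have "\<dots> = (\<integral>\<^sup>+x. ennreal (exp (- (c * x\<^sup>2))) \<partial>lborel)"
    using d by (simp flip: ennreal_mult' mult.assoc)
  finally show ?thesis using d by (simp flip: ennreal_mult' add: real_sqrt_divide d_def)
qed

text \<open>The squared norm splits over the basis, so after a translation the integral factors into
  one-dimensional ones. It is used with \<open>c = 1 / (16 * h)\<close>.\<close>

lemma nn_integral_gaussian:
  fixes c :: real and x :: "'a::euclidean_space"
  assumes "c > 0"
  shows "(\<integral>\<^sup>+y. ennreal (exp (- (c * (norm (x - y))\<^sup>2))) \<partial>lborel) = ennreal ((pi / c) powr (DIM('a) / 2))"
proof -
  have "(\<integral>\<^sup>+y. ennreal (exp (- (c * (norm (x - y))\<^sup>2))) \<partial>lborel)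
      = (\<integral>\<^sup>+y. ennreal (exp (- (c * (norm (x - y))\<^sup>2))) \<partial>(distr lborel borel ((+) x)))"
    by (simp add: lborel_distr_plus)
  also have "\<dots> = (\<integral>\<^sup>+(y::'a). ennreal (exp (- (c * (norm y)\<^sup>2))) \<partial>lborel)"
    by (subst nn_integral_distr) auto
  also have "\<dots> = (\<integral>\<^sup>+(y::'a). (\<Prod>b\<in>Basis. ennreal (exp (- (c * (y \<bullet> b)\<^sup>2)))) \<partial>lborel)"
  proof -
    have "exp (- (c * (norm y)\<^sup>2)) = (\<Prod>b\<in>Basis. exp (- (c * (y \<bullet> b)\<^sup>2)))" for y :: 'a
    proof -
      have "(norm y)\<^sup>2 = (\<Sum>b\<in>Basis. (y \<bullet> b)\<^sup>2)"
        by (subst power2_norm_eq_inner, subst euclidean_inner) (simp only: power2_eq_square)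
      then have "- (c * (norm y)\<^sup>2) = (\<Sum>b\<in>Basis. - (c * (y \<bullet> b)\<^sup>2))"
        by (simp only: sum_distrib_left sum_negf)
      then show ?thesis by (simp only: exp_sum finite_Basis)
    qed
    then show ?thesis by (simp only: prod_ennreal exp_ge_zero)
  qed
  also have "\<dots> = (\<Prod>b\<in>(Basis::'a set). ennreal (sqrt (pi / c)))"
    using assms by (subst nn_integral_lborel_prod) (auto simp: nn_integral_gaussian_real)
  also have "\<dots> = ennreal (sqrt (pi / c) ^ DIM('a))"
    using assms by (simp add: ennreal_power)
  also have "sqrt (pi / c) ^ DIM('a) = (pi / c) powr (DIM('a) / 2)"
  proof -
    have 1: "sqrt (pi / c) = (pi / c) powr (1 / 2)"
      using assms by (intro powr_half_sqrt[symmetric]) auto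
    have "sqrt (pi / c) ^ DIM('a) = sqrt (pi / c) powr real DIM('a)"
      using assms by (intro powr_realpow[symmetric]) auto
    then show ?thesis unfolding 1 powr_powr by simp
  qed
  finally show ?thesis .
qed

lemma nn_integral_powr_from_0:
  fixes b r :: real
  assumes "b > -1" "r \<ge> 0"
  shows "(\<integral>\<^sup>+h. ennreal (h powr b * indicator {0..r} h) \<partial>lborel) = ennreal (r powr (b + 1) / (b + 1))"
proof (rule nn_integral_has_integral_lborel)
  show "((\<lambda>h. h powr b * indicator {0..r} h) has_integral r powr (b + 1) / (b + 1)) UNIV"
    using has_integral_powr_from_0[OF assms] has_integral_restrict_UNIV[of "{0..r}" "\<lambda>h. h powr b"]
    by (simp add: indicator_def of_bool_def if_distrib cong: if_cong)
qed auto

lemma nn_integral_powr_to_inf: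
  fixes b r :: real
  assumes "b < -1" "r > 0"
  shows "(\<integral>\<^sup>+h. ennreal (h powr b * indicator {r..} h) \<partial>lborel) = ennreal (- (r powr (b + 1)) / (b + 1))"
proof (rule nn_integral_has_integral_lborel)
  show "((\<lambda>h. h powr b * indicator {r..} h) has_integral - (r powr (b + 1)) / (b + 1)) UNIV"
    using has_integral_powr_to_inf[OF assms] has_integral_restrict_UNIV[of "{r..}" "\<lambda>h. h powr b"]
    by (simp add: indicator_def of_bool_def if_distrib cong: if_cong)
qed auto

lemma nn_integral_inverse_interval:
  fixes r R :: real
  assumes "0 < r" "r \<le> R"
  shows "(\<integral>\<^sup>+h. ennreal (1 / h * indicator {r..R} h) \<partial>lborel) = ennreal (ln R - ln r)"
proof (rule nn_integral_has_integral_lborel)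
  have "((\<lambda>h. 1 / h) has_integral (ln R - ln r)) {r..R}"
    using assms by (intro fundamental_theorem_of_calculus)
      (auto intro!: derivative_eq_intros simp: has_real_derivative_iff_has_vector_derivative[symmetric])
  then show "((\<lambda>h. 1 / h * indicator {r..R} h) has_integral ln R - ln r) UNIV"
    using has_integral_restrict_UNIV[of "{r..R}" "\<lambda>h. 1 / h"]
    by (simp add: indicator_def of_bool_def if_distrib cong: if_cong)
qed (use assms in \<open>auto simp: indicator_def\<close>)

text \<open>The common source of all the powers. The integral is split at \<open>h = r\<close>,
  where the minimum switches; \<open>a > -1\<close> gives convergence at 0,
  \<open>\<delta> > a + 1\<close> at infinity, and both pieces scale like
  \<open>r powr (a + 1)\<close>. Shifts use \<open>\<delta> = 1/2\<close> with \<open>r\<close> the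
  squared length, time steps \<open>\<delta> = 1\<close> with \<open>r\<close> the step.\<close>

lemma nn_integral_powr_min_le:
  fixes a \<delta> r :: real
  assumes a: "a > -1" and d: "\<delta> > a + 1" and r: "r > 0"
  shows "(\<integral>\<^sup>+h. ennreal (h powr a * min 1 ((r / h) powr \<delta>) * indicator {0<..} h) \<partial>lborel)
    \<le> ennreal ((1 / (a + 1) + 1 / (\<delta> - a - 1)) * r powr (a + 1))"
proof -
  have "(\<integral>\<^sup>+h. ennreal (h powr a * min 1 ((r / h) powr \<delta>) * indicator {0<..} h) \<partial>lborel)
    \<le> (\<integral>\<^sup>+h. ennreal (h powr a * indicator {0..r} h) +
            ennreal (r powr \<delta>) * ennreal (h powr (a - \<delta>) * indicator {r..} h) \<partial>lborel)"
  proof (rule nn_integral_mono)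
    fix h :: real
    have "h powr a * min 1 ((r / h) powr \<delta>) \<le> r powr \<delta> * h powr (a - \<delta>)" if "h > 0"
    proof -
      have "h powr a * min 1 ((r / h) powr \<delta>) \<le> h powr a * ((r / h) powr \<delta>)"
        by (intro mult_left_mono) auto
      also have "\<dots> = r powr \<delta> * h powr (a - \<delta>)"
        using that r by (simp add: powr_divide powr_diff)
      finally show ?thesis .
    qed
    then show "ennreal (h powr a * min 1 ((r / h) powr \<delta>) * indicator {0<..} h)
      \<le> ennreal (h powr a * indicator {0..r} h) + ennreal (r powr \<delta>) * ennreal (h powr (a - \<delta>) * indicator {r..} h)"
      using r by (auto simp: indicator_def ennreal_mult'[symmetric] intro!: ennreal_leI mult_left_le)
  qed
  also have "\<dots> = ennreal (r powr (a + 1) / (a + 1)) +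
            ennreal (r powr \<delta>) * ennreal (- (r powr (a - \<delta> + 1)) / (a - \<delta> + 1))"
    using assms by (subst nn_integral_add, simp, simp, subst nn_integral_cmult, simp)
      (simp add: nn_integral_powr_from_0 nn_integral_powr_to_inf)
  also have "\<dots> = ennreal ((1 / (a + 1) + 1 / (\<delta> - a - 1)) * r powr (a + 1))"
  proof -
    have 1: "- (r powr (a - \<delta> + 1)) / (a - \<delta> + 1) = r powr (a - \<delta> + 1) / (\<delta> - a - 1)"
    proof -
      have "a - \<delta> + 1 = - (\<delta> - a - 1)" by simp
      then show ?thesis by (metis minus_divide_left minus_divide_right minus_minus)
    qed
    have 2: "r powr \<delta> * r powr (a - \<delta> + 1) = r powr (a + 1)"
      by (simp flip: powr_add)
    have "ennreal (r powr \<delta>) * ennreal (r powr (a - \<delta> + 1) / (\<delta> - a - 1)) = ennreal (r powr (a + 1) / (\<delta> - a - 1))"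
      by (subst 2[symmetric]) (use assms in \<open>simp flip: ennreal_mult'\<close>)
    then show ?thesis
      unfolding 1 using assms by (simp flip: ennreal_plus add: distrib_right)
  qed
  finally show ?thesis .
qed

lemma nn_integral_reflect:
  fixes \<psi> :: "real \<Rightarrow> ennreal"
  assumes "\<psi> \<in> borel_measurable borel"
  shows "(\<integral>\<^sup>+\<tau>. \<psi> (t - \<tau>) \<partial>lborel) = (\<integral>\<^sup>+h. \<psi> h \<partial>lborel)"
  using nn_integral_real_affine[OF assms, of "-1" t] by simp

section \<open>Gaussian profiles\<close>

text \<open>The quadratic term of the exponential series at \<open>r\<^sup>2 / 16\<close> is
  \<open>r ^ 4 / 512\<close>, whence the 512 and the limit on \<open>j\<close>. A polynomial factor
  is thus absorbed at the price of 1/16 in the Gaussian rate.\<close>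

lemma power_le_exp_square:
  fixes r :: real
  assumes "0 \<le> r" "j \<le> 4"
  shows "r ^ j \<le> 512 * exp (r\<^sup>2 / 16)"
proof -
  have "r ^ j \<le> max 1 (r ^ 4)"
  proof (cases "r \<le> 1")
    case True then show ?thesis using assms power_le_one[of r j] by auto
  next
    case False then show ?thesis using power_increasing[of j 4 r] assms by auto
  qed
  moreover have "r ^ 4 \<le> 512 * exp (r\<^sup>2 / 16)"
  proof -
    have "1 + r\<^sup>2 / 16 + r ^ 4 / 512 \<le> exp (r\<^sup>2 / 16)"
      using exp_lower_Taylor_quadratic[of "r\<^sup>2 / 16"] by (simp add: power_divide)
    then show ?thesis using zero_le_power2[of r] by linarith
  qed
  moreover have "1 \<le> exp (r\<^sup>2 / 16)" by simp
  ultimately show ?thesis by (smt (verit))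
qed

text \<open>The right side depends on \<open>\<zeta>\<close> alone, uniformly over the unit ball
  around it, so the mean value theorem can be used on that ball with a majorant integrable in
  \<open>\<zeta>\<close>. The rate 1/4 drops to 3/16 by absorbing the moment and to 1/16 by undoing
  the shift.\<close>

lemma shifted_gaussian_moment_le:
  fixes \<zeta> \<eta> :: "'a::real_inner"
  assumes "norm \<eta> \<le> 1" "j \<le> 4"
  shows "norm (\<zeta> + \<eta>) ^ j * exp (- ((norm (\<zeta> + \<eta>))\<^sup>2 / 4)) \<le> 1024 * exp (- ((norm \<zeta>)\<^sup>2 / 16))"
proof -
  define u where "u = norm (\<zeta> + \<eta>)"
  have "norm \<zeta> \<le> u + 1"
    using norm_triangle_ineq4[of "\<zeta> + \<eta>" \<eta>] assms by (simp add: u_def)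
  then have "(norm \<zeta>)\<^sup>2 \<le> (u + 1)\<^sup>2" by (simp add: power_mono)
  also have "\<dots> \<le> 2 * u\<^sup>2 + 2" using zero_le_power2[of "u - 1"] by (simp add: power2_eq_square algebra_simps)
  finally have *: "(norm \<zeta>)\<^sup>2 \<le> 2 * u\<^sup>2 + 2" .
  have "u ^ j * exp (- (u\<^sup>2 / 4)) \<le> 512 * exp (u\<^sup>2 / 16) * exp (- (u\<^sup>2 / 4))"
    using power_le_exp_square[of u j] assms by (intro mult_right_mono) (auto simp: u_def)
  also have "\<dots> = 512 * exp (- (3 * u\<^sup>2 / 16))" by (simp flip: exp_add)
  also have "\<dots> \<le> 512 * exp (1 / 4 + - ((norm \<zeta>)\<^sup>2 / 16))"
  proof -
    have "- (3 * u\<^sup>2 / 16) \<le> 1 / 4 + - ((norm \<zeta>)\<^sup>2 / 16)"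
      using * zero_le_power2[of u] by linarith
    then show ?thesis by simp
  qed
  also have "\<dots> = 512 * exp (1/4) * exp (- ((norm \<zeta>)\<^sup>2 / 16))" by (simp only: exp_add mult.assoc)
  also have "\<dots> \<le> 1024 * exp (- ((norm \<zeta>)\<^sup>2 / 16))"
  proof -
    have "exp (1/4::real) \<le> 2" using exp_bound_half[of "1/4::real"] by simp
    then show ?thesis by simp
  qed
  finally show ?thesis by (simp add: u_def)
qed

definition gauss_profile :: "'a::real_inner \<Rightarrow> real" where
  "gauss_profile z = exp (- ((norm z)\<^sup>2 / 4))"

text \<open>This is the gradient of \<open>gauss_profile\<close>, kept as a vector so that the
  spatial gradient of the kernel is again self-similar with a single profile.\<close>

definition grad_profile :: "'a::real_inner \<Rightarrow> 'a" where
  "grad_profile z = (- (gauss_profile z / 2)) *\<^sub>R z"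

lemma gauss_profile_pos: "0 < gauss_profile z"
  by (simp add: gauss_profile_def)

lemma gauss_profile_moment_le:
  assumes "norm \<eta> \<le> 1" "j \<le> 4"
  shows "norm (\<zeta> + \<eta>) ^ j * gauss_profile (\<zeta> + \<eta>) \<le> 1024 * exp (- ((norm \<zeta>)\<^sup>2 / 16))"
  using shifted_gaussian_moment_le[OF assms] by (simp add: gauss_profile_def)

lemma has_derivative_gauss_profile:
  "(gauss_profile has_derivative (\<lambda>v. v \<bullet> grad_profile z)) (at z within S)"
proof -
  have "((\<lambda>z. - (z \<bullet> z) / 4) has_derivative (\<lambda>v. - (2 * (z \<bullet> v)) / 4)) (at z within S)"
    by (auto intro!: derivative_eq_intros simp: inner_commute)
  from has_derivative_exp[OF this]
  have "((\<lambda>z. exp (- (z \<bullet> z) / 4)) has_derivative (\<lambda>v. v \<bullet> grad_profile z)) (at z within S)"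
    by (rule has_derivative_eq_rhs)
      (simp add: fun_eq_iff grad_profile_def gauss_profile_def power2_norm_eq_inner inner_commute)
  moreover have "gauss_profile = (\<lambda>z::'a. exp (- (z \<bullet> z) / 4))"
    by (simp add: fun_eq_iff gauss_profile_def power2_norm_eq_inner)
  ultimately show ?thesis by simp
qed

lemma has_derivative_grad_profile:
  "(grad_profile has_derivative
     (\<lambda>v. (- (gauss_profile z / 2)) *\<^sub>R v - ((v \<bullet> grad_profile z) / 2) *\<^sub>R z)) (at z within S)"
proof -
  have "((\<lambda>z. (- (1 / 2)) *\<^sub>R (gauss_profile z *\<^sub>R z)) has_derivative
     (\<lambda>v. (- (1 / 2)) *\<^sub>R (gauss_profile z *\<^sub>R v + (v \<bullet> grad_profile z) *\<^sub>R z))) (at z within S)"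
    by (intro has_derivative_scaleR_right has_derivative_scaleR has_derivative_gauss_profile has_derivative_ident)
  moreover have "grad_profile = (\<lambda>z::'a. (- (1 / 2)) *\<^sub>R (gauss_profile z *\<^sub>R z))"
    by (simp add: fun_eq_iff grad_profile_def)
  moreover have "(\<lambda>v. (- (1 / 2)) *\<^sub>R (gauss_profile z *\<^sub>R v + (v \<bullet> grad_profile z) *\<^sub>R z)) =
      (\<lambda>v. (- (gauss_profile z / 2)) *\<^sub>R v - ((v \<bullet> grad_profile z) / 2) *\<^sub>R z)"
    by (simp add: fun_eq_iff scaleR_add_right)
  ultimately show ?thesis by (simp only:)
qed

lemma continuous_on_gauss_profile: "continuous_on S gauss_profile"
  by (rule has_derivative_continuous_on[OF has_derivative_gauss_profile])

lemma continuous_on_grad_profile: "continuous_on S grad_profile"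
  by (rule has_derivative_continuous_on[OF has_derivative_grad_profile])

lemma norm_grad_profile: "norm (grad_profile z) = norm z * gauss_profile z / 2"
  using gauss_profile_pos[of z] by (simp add: grad_profile_def)

lemma gauss_profile_le: "norm (gauss_profile \<zeta>) \<le> 1024 * exp (- ((norm \<zeta>)\<^sup>2 / 16))"
  using gauss_profile_moment_le[of 0 0 \<zeta>] gauss_profile_pos[of \<zeta>] by simp

lemma grad_profile_le: "norm (grad_profile \<zeta>) \<le> 512 * exp (- ((norm \<zeta>)\<^sup>2 / 16))"
  using gauss_profile_moment_le[of 0 1 \<zeta>] by (simp add: norm_grad_profile)

lemma onorm_inner_left_le:
  assumes "norm w \<le> B"
  shows "onorm (\<lambda>v. v \<bullet> w) \<le> B"
proof (rule onorm_bound)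
  show "0 \<le> B" using assms norm_ge_zero order.trans by blast
  show "norm (v \<bullet> w) \<le> B * norm v" for v
    using Cauchy_Schwarz_ineq2[of v w] mult_right_mono[OF assms, of "norm v"] by (simp add: mult.commute)
qed

text \<open>Mean value inequality on the unit ball around \<open>\<zeta>\<close>: the gradient is
  half a first moment, hence 512.\<close>

lemma gauss_profile_diff_le:
  assumes "norm \<eta> \<le> 1"
  shows "norm (gauss_profile (\<zeta> + \<eta>) - gauss_profile \<zeta>) \<le> 512 * norm \<eta> * exp (- ((norm \<zeta>)\<^sup>2 / 16))"
proof -
  have "norm (gauss_profile (\<zeta> + \<eta>) - gauss_profile \<zeta>) \<le> (512 * exp (- ((norm \<zeta>)\<^sup>2 / 16))) * norm (\<zeta> + \<eta> - \<zeta>)"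
  proof (rule differentiable_bound[OF convex_cball[of \<zeta> 1] has_derivative_gauss_profile])
    fix x assume "x \<in> cball \<zeta> 1"
    then have 1: "norm (x - \<zeta>) \<le> 1" by (simp add: dist_norm norm_minus_commute)
    have "norm (grad_profile x) \<le> 512 * exp (- ((norm \<zeta>)\<^sup>2 / 16))"
      using gauss_profile_moment_le[OF 1, of 1 \<zeta>] by (simp add: norm_grad_profile)
    then show "onorm (\<lambda>v. v \<bullet> grad_profile x) \<le> 512 * exp (- ((norm \<zeta>)\<^sup>2 / 16))"
      by (rule onorm_inner_left_le)
  qed (use assms in \<open>auto simp: dist_norm\<close>)
  then show ?thesis by (simp add: algebra_simps)
qed

text \<open>The derivative has one term with moment 0 and weight 1/2 and one with moment 2 and
  weight 1/4, and 1024 times 3/4 is 768.\<close>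

lemma grad_profile_diff_le:
  assumes "norm \<eta> \<le> 1"
  shows "norm (grad_profile (\<zeta> + \<eta>) - grad_profile \<zeta>) \<le> 768 * norm \<eta> * exp (- ((norm \<zeta>)\<^sup>2 / 16))"
proof -
  have "norm (grad_profile (\<zeta> + \<eta>) - grad_profile \<zeta>) \<le> (768 * exp (- ((norm \<zeta>)\<^sup>2 / 16))) * norm (\<zeta> + \<eta> - \<zeta>)"
  proof (rule differentiable_bound[OF convex_cball[of \<zeta> 1] has_derivative_grad_profile])
    fix x assume "x \<in> cball \<zeta> 1"
    then have 1: "norm (x - \<zeta>) \<le> 1" by (simp add: dist_norm norm_minus_commute)
    note m = gauss_profile_moment_le[OF 1, of 0 \<zeta>] gauss_profile_moment_le[OF 1, of 2 \<zeta>]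
    show "onorm (\<lambda>v. (- (gauss_profile x / 2)) *\<^sub>R v - ((v \<bullet> grad_profile x) / 2) *\<^sub>R x) \<le> 768 * exp (- ((norm \<zeta>)\<^sup>2 / 16))"
    proof (rule onorm_bound)
      fix v
      have "norm ((- (gauss_profile x / 2)) *\<^sub>R v - ((v \<bullet> grad_profile x) / 2) *\<^sub>R x)
         \<le> gauss_profile x / 2 * norm v + \<bar>v \<bullet> grad_profile x\<bar> / 2 * norm x"
        by (rule order.trans[OF norm_triangle_ineq4]) (use gauss_profile_pos[of x] in simp)
      also have "\<dots> \<le> gauss_profile x / 2 * norm v + norm v * norm (grad_profile x) / 2 * norm x"
        by (intro add_left_mono mult_right_mono divide_right_mono Cauchy_Schwarz_ineq2) auto
      also have "\<dots> = (gauss_profile x / 2 + norm x ^ 2 * gauss_profile x / 4) * norm v"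
        by (simp add: norm_grad_profile power2_eq_square algebra_simps)
      also have "\<dots> \<le> (768 * exp (- ((norm \<zeta>)\<^sup>2 / 16))) * norm v"
        using m by (intro mult_right_mono) auto
      finally show "norm ((- (gauss_profile x / 2)) *\<^sub>R v - ((v \<bullet> grad_profile x) / 2) *\<^sub>R x)
         \<le> 768 * exp (- ((norm \<zeta>)\<^sup>2 / 16)) * norm v" .
    qed auto
  qed (use assms in \<open>auto simp: dist_norm\<close>)
  then show ?thesis by (simp add: algebra_simps)
qed

text \<open>The linearization error is at most \<open>norm \<eta>\<close> times the oscillation of
  the gradient on the ball of radius \<open>norm \<eta>\<close>, which
  \<open>grad_profile_diff_le\<close> controls; no second derivative is formed.\<close>

lemma gauss_profile_taylor_le:
  assumes "norm \<eta> \<le> 1"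
  shows "norm (gauss_profile (\<zeta> + \<eta>) - gauss_profile \<zeta> - \<eta> \<bullet> grad_profile \<zeta>)
    \<le> 768 * (norm \<eta>)\<^sup>2 * exp (- ((norm \<zeta>)\<^sup>2 / 16))"
proof -
  have "norm (gauss_profile (\<zeta> + \<eta>) - gauss_profile \<zeta> - (\<lambda>x v. v \<bullet> grad_profile x) \<zeta> ((\<zeta> + \<eta>) - \<zeta>))
     \<le> norm ((\<zeta> + \<eta>) - \<zeta>) * (768 * norm \<eta> * exp (- ((norm \<zeta>)\<^sup>2 / 16)))"
  proof (rule differentiable_bound_linearization[where S="cball \<zeta> (norm \<eta>)"
        and f'="\<lambda>x v. v \<bullet> grad_profile x" and ?x0.0=\<zeta>])
    show "\<zeta> + t *\<^sub>R (\<zeta> + \<eta> - \<zeta>) \<in> cball \<zeta> (norm \<eta>)" if "t \<in> {0..1}" for t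
      using that by (auto simp: dist_norm mult_left_le_one_le)
    fix x assume x: "x \<in> cball \<zeta> (norm \<eta>)"
    have "norm (grad_profile x - grad_profile \<zeta>) \<le> 768 * norm (x - \<zeta>) * exp (- ((norm \<zeta>)\<^sup>2 / 16))"
      using grad_profile_diff_le[of "x - \<zeta>" \<zeta>] x assms by (simp add: dist_norm norm_minus_commute)
    also have "\<dots> \<le> 768 * norm \<eta> * exp (- ((norm \<zeta>)\<^sup>2 / 16))"
      using x by (auto simp: dist_norm norm_minus_commute)
    finally have *: "norm (grad_profile x - grad_profile \<zeta>) \<le> 768 * norm \<eta> * exp (- ((norm \<zeta>)\<^sup>2 / 16))" .
    show "onorm ((\<lambda>v. v \<bullet> grad_profile x) - (\<lambda>v. v \<bullet> grad_profile \<zeta>)) \<le> 768 * norm \<eta> * exp (- ((norm \<zeta>)\<^sup>2 / 16))"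
      using onorm_inner_left_le[OF *] by (simp add: inner_diff_right fun_diff_def)
  qed (auto intro: has_derivative_gauss_profile)
  then show ?thesis by (simp add: power2_eq_square algebra_simps)
qed

text \<open>Mean value theorem in the dilation parameter. On [1,2] the exponential is at most
  \<open>exp (- (r\<^sup>2 / 8))\<close>; the derivative costs \<open>p\<close> from the power and
  \<open>r\<^sup>2\<close> from the exponent.\<close>

lemma dilated_gaussian_diff_le:
  fixes p r \<sigma> :: real
  assumes p: "0 \<le> p" and l: "1 \<le> \<sigma>" "\<sigma> \<le> 2"
  shows "\<bar>\<sigma> powr (- p) * exp (- (r\<^sup>2 / (4 * \<sigma>))) - exp (- (r\<^sup>2 / 4))\<bar>
     \<le> (\<sigma> - 1) * ((p + r\<^sup>2) * exp (- (r\<^sup>2 / 8)))"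
proof -
  let ?F = "\<lambda>l. l powr (- p) * exp (- (r\<^sup>2 / (4 * l)))"
  let ?F' = "\<lambda>l. (- p) * l powr (- p - 1) * exp (- (r\<^sup>2 / (4 * l))) + l powr (- p) * (exp (- (r\<^sup>2 / (4 * l))) * (r\<^sup>2 / (4 * l\<^sup>2)))"
  have "norm (?F \<sigma> - ?F 1) \<le> ((p + r\<^sup>2) * exp (- (r\<^sup>2 / 8))) * norm (\<sigma> - 1)"
  proof (rule field_differentiable_bound[where f = ?F and S = "{1..2}" and f' = ?F'])
    fix l :: real assume "l \<in> {1..2}"
    then have l: "1 \<le> l" "l \<le> 2" by auto
    show "(?F has_field_derivative ?F' l) (at l within {1..2})"
    proof -
      have "((\<lambda>l. - (r\<^sup>2 / (4 * l))) has_field_derivative r\<^sup>2 / (4 * l\<^sup>2)) (at l)"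
        using l by (auto intro!: derivative_eq_intros simp: power2_eq_square)
      from DERIV_mult[OF has_real_derivative_powr[of l "- p"] DERIV_fun_exp[OF this]] l
      have "(?F has_field_derivative (- p) * l powr (- p - 1) * exp (- (r\<^sup>2 / (4 * l))) +
          (exp (- (r\<^sup>2 / (4 * l))) * (r\<^sup>2 / (4 * l\<^sup>2))) * l powr (- p)) (at l)" by simp
      then have "(?F has_field_derivative ?F' l) (at l)"
        by (rule DERIV_cong) (simp only: mult_ac)
      then show ?thesis by (rule has_field_derivative_at_within)
    qed
    have 1: "l powr (- p) \<le> 1" "l powr (- p - 1) \<le> 1" 
      using l p powr_mono[of "- p" 0 l] powr_mono[of "- p - 1" 0 l] by auto
    have 2: "exp (- (r\<^sup>2 / (4 * l))) \<le> exp (- (r\<^sup>2 / 8))"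
    proof -
      have "r\<^sup>2 / 8 \<le> r\<^sup>2 / (4 * l)" using l by (intro divide_left_mono) auto
      then show ?thesis by simp
    qed
    have 3: "r\<^sup>2 / (4 * l\<^sup>2) \<le> r\<^sup>2"
    proof -
      have "1 \<le> 4 * l\<^sup>2" using l one_le_power[of l 2] by linarith
      then show ?thesis by (simp add: divide_le_eq mult_le_cancel_left1)
    qed
    have "norm (?F' l) \<le> norm ((- p) * l powr (- p - 1) * exp (- (r\<^sup>2 / (4 * l)))) + norm (l powr (- p) * (exp (- (r\<^sup>2 / (4 * l))) * (r\<^sup>2 / (4 * l\<^sup>2))))"
      by (rule norm_triangle_ineq)
    also have "\<dots> = p * l powr (- p - 1) * exp (- (r\<^sup>2 / (4 * l))) + l powr (- p) * (exp (- (r\<^sup>2 / (4 * l))) * (r\<^sup>2 / (4 * l\<^sup>2)))"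
      using p by (simp add: abs_mult)
    also have "\<dots> \<le> p * 1 * exp (- (r\<^sup>2 / 8)) + 1 * (exp (- (r\<^sup>2 / 8)) * r\<^sup>2)"
      using p by (intro add_mono mult_mono 1 2 3) auto
    finally show "norm (?F' l) \<le> (p + r\<^sup>2) * exp (- (r\<^sup>2 / 8))" by (simp add: algebra_simps)
  qed (use l in auto)
  then show ?thesis using l by (simp add: mult.commute)
qed

lemma moment_gaussian_eighth_le:
  fixes r :: real
  assumes "0 \<le> r" "j \<le> 4"
  shows "r ^ j * exp (- (r\<^sup>2 / 8)) \<le> 512 * exp (- (r\<^sup>2 / 16))"
proof -
  have "r ^ j * exp (- (r\<^sup>2 / 8)) \<le> 512 * exp (r\<^sup>2 / 16) * exp (- (r\<^sup>2 / 8))"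
    by (intro mult_right_mono power_le_exp_square assms) auto
  also have "\<dots> = 512 * exp (- (r\<^sup>2 / 16))" by (simp flip: exp_add)
  finally show ?thesis .
qed

lemma gauss_profile_rescale:
  assumes "0 < \<sigma>"
  shows "gauss_profile (\<zeta> /\<^sub>R sqrt \<sigma>) = exp (- ((norm \<zeta>)\<^sup>2 / (4 * \<sigma>)))"
proof -
  have "norm (\<zeta> /\<^sub>R sqrt \<sigma>) = norm \<zeta> / sqrt \<sigma>"
    using assms by (simp add: divide_inverse)
  then have "(norm (\<zeta> /\<^sub>R sqrt \<sigma>))\<^sup>2 = (norm \<zeta>)\<^sup>2 / \<sigma>"
    using assms by (simp add: power_divide)
  then show ?thesis by (simp add: gauss_profile_def)
qed

lemma gauss_profile_dilate_le:
  assumes p: "0 \<le> p" and l: "1 \<le> \<sigma>" "\<sigma> \<le> 2"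
  shows "norm (\<sigma> powr (- p) *\<^sub>R gauss_profile (\<zeta> /\<^sub>R sqrt \<sigma>) - gauss_profile \<zeta>)
     \<le> 512 * (p + 1) * (\<sigma> - 1) * exp (- ((norm \<zeta>)\<^sup>2 / 16))"
proof -
  define r where "r = norm \<zeta>"
  have g: "gauss_profile (\<zeta> /\<^sub>R sqrt \<sigma>) = exp (- (r\<^sup>2 / (4 * \<sigma>)))"
    using l by (simp add: gauss_profile_rescale r_def)
  have "norm (\<sigma> powr (- p) *\<^sub>R gauss_profile (\<zeta> /\<^sub>R sqrt \<sigma>) - gauss_profile \<zeta>)
     \<le> (\<sigma> - 1) * ((p + r\<^sup>2) * exp (- (r\<^sup>2 / 8)))"
    using dilated_gaussian_diff_le[OF assms, of r] unfolding g by (simp add: gauss_profile_def r_def)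
  also have "\<dots> \<le> (\<sigma> - 1) * (p * (512 * exp (- (r\<^sup>2 / 16))) + 512 * exp (- (r\<^sup>2 / 16)))"
    using moment_gaussian_eighth_le[of r 0] moment_gaussian_eighth_le[of r 2] p l
    unfolding distrib_right by (intro mult_left_mono add_mono) (auto simp: r_def)
  finally show ?thesis by (simp add: r_def algebra_simps)
qed

text \<open>The linear factor of the profile contributes a further \<open>1 / sqrt \<sigma>\<close>,
  so the scalar estimate is applied with exponent \<open>p + 1/2\<close>; the remaining factor
  \<open>norm \<zeta> / 2\<close> raises the moments to 1 and 3.\<close>

lemma grad_profile_dilate_le:
  assumes p: "0 \<le> p" and l: "1 \<le> \<sigma>" "\<sigma> \<le> 2"
  shows "norm (\<sigma> powr (- p) *\<^sub>R grad_profile (\<zeta> /\<^sub>R sqrt \<sigma>) - grad_profile \<zeta>)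
     \<le> 512 * (p + 2) * (\<sigma> - 1) * exp (- ((norm \<zeta>)\<^sup>2 / 16))"
proof -
  define r where "r = norm \<zeta>"
  have g: "gauss_profile (\<zeta> /\<^sub>R sqrt \<sigma>) = exp (- (r\<^sup>2 / (4 * \<sigma>)))"
    using l by (simp add: gauss_profile_rescale r_def)
  let ?D = "\<sigma> powr (- (p + 1/2)) * exp (- (r\<^sup>2 / (4 * \<sigma>))) - exp (- (r\<^sup>2 / 4))"
  have "\<sigma> powr (- (p + 1/2)) = \<sigma> powr (- p) / sqrt \<sigma>"
    using l by (simp add: powr_diff powr_half_sqrt)
  then have D: "?D = \<sigma> powr (- p) / sqrt \<sigma> * exp (- (r\<^sup>2 / (4 * \<sigma>))) - exp (- (r\<^sup>2 / 4))"
    by (simp only:)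
  have "\<sigma> powr (- p) *\<^sub>R grad_profile (\<zeta> /\<^sub>R sqrt \<sigma>) =
      (- (\<sigma> powr (- p) / sqrt \<sigma> * exp (- (r\<^sup>2 / (4 * \<sigma>))) / 2)) *\<^sub>R \<zeta>"
  proof -
    have "a * (- (b / 2) * inverse c) = - (a / c * b / 2)" for a b c :: real
      by (simp add: inverse_eq_divide)
    then show ?thesis unfolding grad_profile_def g scaleR_scaleR by (simp only:)
  qed
  moreover have "grad_profile \<zeta> = (- (exp (- (r\<^sup>2 / 4)) / 2)) *\<^sub>R \<zeta>"
    by (simp add: grad_profile_def gauss_profile_def r_def)
  ultimately have "\<sigma> powr (- p) *\<^sub>R grad_profile (\<zeta> /\<^sub>R sqrt \<sigma>) - grad_profile \<zeta> = (- (?D / 2)) *\<^sub>R \<zeta>"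
    unfolding D by (simp add: scaleR_diff_left diff_divide_distrib)
  then have "norm (\<sigma> powr (- p) *\<^sub>R grad_profile (\<zeta> /\<^sub>R sqrt \<sigma>) - grad_profile \<zeta>) = \<bar>?D\<bar> / 2 * r"
    by (simp add: r_def)
  also have "\<dots> \<le> (\<sigma> - 1) * ((p + 1/2 + r\<^sup>2) * exp (- (r\<^sup>2 / 8))) / 2 * r"
    using dilated_gaussian_diff_le[of "p + 1/2" \<sigma> r] assms by (intro mult_right_mono divide_right_mono) (auto simp: r_def)
  also have "\<dots> = (\<sigma> - 1) / 2 * ((p + 1/2) * (r ^ 1 * exp (- (r\<^sup>2 / 8))) + r ^ 3 * exp (- (r\<^sup>2 / 8)))"
  proof -
    have "m * ((c + r\<^sup>2) * e) / 2 * r = m / 2 * (c * (r ^ 1 * e) + r ^ 3 * e)" for m c e :: real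
      by (simp add: power2_eq_square power3_eq_cube distrib_left distrib_right mult_ac)
    then show ?thesis .
  qed
  also have "\<dots> \<le> (\<sigma> - 1) / 2 * ((p + 1/2) * (512 * exp (- (r\<^sup>2 / 16))) + 512 * exp (- (r\<^sup>2 / 16)))"
    using p l by (intro mult_left_mono add_mono moment_gaussian_eighth_le) (auto simp: r_def)
  also have "\<dots> = 512 * (p / 2 + 3 / 4) * (\<sigma> - 1) * exp (- (r\<^sup>2 / 16))" by (simp add: field_simps)
  also have "\<dots> \<le> 512 * (p + 2) * (\<sigma> - 1) * exp (- (r\<^sup>2 / 16))"
    using p l by (intro mult_right_mono) auto
  finally show ?thesis by (simp add: r_def)
qed

section \<open>Potentials of self-similar kernels\<close>

lemma measurable_fst_borel [measurable]: "fst \<in> borel_measurable (borel :: ('a::euclidean_space \<times> real) measure)"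
  by (intro borel_measurable_continuous_onI continuous_intros)

lemma measurable_snd_borel [measurable]: "snd \<in> borel_measurable (borel :: ('a::euclidean_space \<times> real) measure)"
  by (intro borel_measurable_continuous_onI continuous_intros)

text \<open>The threshold \<open>4\<close> is the half-length in time of the cylinder of radius \<open>2\<close>.\<close>

definition bounded_source :: "('a::euclidean_space \<times> real \<Rightarrow> real) \<Rightarrow> real \<Rightarrow> bool" where
  "bounded_source g M \<longleftrightarrow>
     g \<in> borel_measurable borel \<and> (\<forall>p. \<bar>g p\<bar> \<le> M) \<and> (\<forall>p. \<bar>snd p\<bar> \<ge> 4 \<longrightarrow> g p = 0)"

lemma bounded_source_nonneg: "bounded_source g M \<Longrightarrow> 0 \<le> M"
  unfolding bounded_source_def by (metis abs_ge_zero order.trans)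

lemma bounded_sourceD:
  assumes "bounded_source g M"
  shows "\<bar>g p\<bar> \<le> M" "4 \<le> \<bar>snd p\<bar> \<Longrightarrow> g p = 0" "g \<in> borel_measurable borel"
  using assms unfolding bounded_source_def by blast+

text \<open>Tonelli with the space variable inside: the source costs its bound \<open>M\<close> and
  confines time to \<open>{-4<..<4}\<close>, after which only the slice integrals of
  \<open>q\<close> matter.\<close>

lemma nn_integral_source_le:
  fixes g :: "'a::euclidean_space \<times> real \<Rightarrow> real" and q :: "'a \<times> real \<Rightarrow> 'b::{banach, second_countable_topology}"
  assumes g: "bounded_source g M" and q [measurable]: "q \<in> borel_measurable borel"
    and F: "\<And>\<tau>. \<bar>\<tau>\<bar> < 4 \<Longrightarrow> (\<integral>\<^sup>+y. ennreal (norm (q (y, \<tau>))) \<partial>lborel) \<le> F \<tau>"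
  shows "(\<integral>\<^sup>+p. ennreal (norm (g p *\<^sub>R q p)) \<partial>lborel) \<le> ennreal M * (\<integral>\<^sup>+\<tau>. F \<tau> * indicator {-4<..<4} \<tau> \<partial>lborel)"
proof -
  have M: "0 \<le> M" using g by (rule bounded_source_nonneg)
  have [measurable]: "(\<lambda>p. ennreal (norm (q p)) * indicator {-4<..<4} (snd p)) \<in> borel_measurable (lborel \<Otimes>\<^sub>M lborel)"
    unfolding lborel_prod measurable_lborel1 by measurable
  have "(\<integral>\<^sup>+p. ennreal (norm (g p *\<^sub>R q p)) \<partial>lborel)
      \<le> (\<integral>\<^sup>+p. ennreal M * (ennreal (norm (q p)) * indicator {-4<..<4} (snd p)) \<partial>lborel)"
  proof (rule nn_integral_mono)
    fix p
    show "ennreal (norm (g p *\<^sub>R q p)) \<le> ennreal M * (ennreal (norm (q p)) * indicator {-4<..<4} (snd p))"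
    proof (cases "\<bar>snd p\<bar> < 4")
      case True
      then have "snd p \<in> {-4<..<4}" by auto
      moreover have "norm (g p *\<^sub>R q p) \<le> M * norm (q p)"
      proof -
        have "\<bar>g p\<bar> \<le> M" using g by (rule bounded_sourceD)
        then show ?thesis by (simp add: mult_right_mono)
      qed
      ultimately show ?thesis using M by (simp add: ennreal_mult'[symmetric] ennreal_leI)
    next
      case False
      then have "g p = 0" using bounded_sourceD(2)[OF g, of p] by simp
      then show ?thesis by simp
    qed
  qed
  also have "\<dots> = ennreal M * (\<integral>\<^sup>+p. ennreal (norm (q p)) * indicator {-4<..<4} (snd p) \<partial>(lborel \<Otimes>\<^sub>M lborel))"
    unfolding lborel_prod by (rule nn_integral_cmult) measurable
  also have "\<dots> = ennreal M * (\<integral>\<^sup>+\<tau>. (\<integral>\<^sup>+y. ennreal (norm (q (y, \<tau>))) * indicator {-4<..<4} \<tau> \<partial>lborel) \<partial>lborel)"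
    by (subst lborel_pair.nn_integral_snd[symmetric]) auto
  also have "\<dots> \<le> ennreal M * (\<integral>\<^sup>+\<tau>. F \<tau> * indicator {-4<..<4} \<tau> \<partial>lborel)"
  proof (intro mult_left_mono nn_integral_mono)
    fix \<tau> :: real
    show "(\<integral>\<^sup>+y. ennreal (norm (q (y, \<tau>))) * indicator {-4<..<4} \<tau> \<partial>lborel) \<le> F \<tau> * indicator {-4<..<4} \<tau>"
      using F[of \<tau>] by (auto simp: indicator_def)
  qed auto
  finally show ?thesis .
qed

lemma integral_source_le:
  fixes g :: "'a::euclidean_space \<times> real \<Rightarrow> real" and q :: "'a \<times> real \<Rightarrow> 'b::{banach, second_countable_topology}"
  assumes g: "bounded_source g M" and q [measurable]: "q \<in> borel_measurable borel"
    and F: "\<And>\<tau>. \<bar>\<tau>\<bar> < 4 \<Longrightarrow> (\<integral>\<^sup>+y. ennreal (norm (q (y, \<tau>))) \<partial>lborel) \<le> F \<tau>"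
    and I: "(\<integral>\<^sup>+\<tau>. F \<tau> * indicator {-4<..<4} \<tau> \<partial>lborel) \<le> ennreal I" "0 \<le> I"
  shows "integrable lborel (\<lambda>p. g p *\<^sub>R q p)" and "norm (\<integral>p. g p *\<^sub>R q p \<partial>lborel) \<le> M * I"
proof -
  have M: "0 \<le> M" using g by (rule bounded_source_nonneg)
  have [measurable]: "g \<in> borel_measurable borel" using g by (rule bounded_sourceD)
  have *: "(\<integral>\<^sup>+p. ennreal (norm (g p *\<^sub>R q p)) \<partial>lborel) \<le> ennreal (M * I)"
    unfolding ennreal_mult'[OF M]
    by (rule order.trans[OF nn_integral_source_le[OF g q F] mult_left_mono[OF I(1)]]) auto
  show 1: "integrable lborel (\<lambda>p. g p *\<^sub>R q p)"
    by (rule integrableI_bounded) (use * in \<open>auto simp: less_top[symmetric] top_unique intro: le_less_trans\<close>)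
  have "ennreal (norm (\<integral>p. g p *\<^sub>R q p \<partial>lborel)) \<le> ennreal (M * I)"
    using integral_norm_bound_ennreal[OF 1] * by (rule order.trans)
  then show "norm (\<integral>p. g p *\<^sub>R q p \<partial>lborel) \<le> M * I"
    using M I by (subst (asm) ennreal_le_iff) auto
qed

text \<open>The power is normalized so that the integral over \<open>z\<close> scales like
  \<open>h powr a\<close>. The value 0 for \<open>h \<le> 0\<close> encodes causality: the
  restriction to past times sits in the kernel, and \<open>potential\<close> can be one integral
  over all of space-time.\<close>

definition self_similar :: "real \<Rightarrow> ('a::euclidean_space \<Rightarrow> 'b::real_normed_vector) \<Rightarrow> 'a \<Rightarrow> real \<Rightarrow> 'b" where
  "self_similar a P z h = (if 0 < h then h powr (a - DIM('a) / 2) *\<^sub>R P (z /\<^sub>R sqrt h) else 0)"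

definition potential ::
  "('a::euclidean_space \<Rightarrow> real \<Rightarrow> 'b::{banach, second_countable_topology}) \<Rightarrow> ('a \<times> real \<Rightarrow> real) \<Rightarrow> 'a \<Rightarrow> real \<Rightarrow> 'b" where
  "potential k g x t = (\<integral>p. g p *\<^sub>R k (x - fst p) (t - snd p) \<partial>lborel)"

lemma borel_measurable_self_similar:
  fixes P :: "'a::euclidean_space \<Rightarrow> 'b::{banach, second_countable_topology}"
  assumes "continuous_on UNIV P"
  shows "(\<lambda>p. self_similar a P (x - fst p) (t - snd p)) \<in> borel_measurable borel"
proof -
  have [measurable]: "P \<in> borel_measurable borel" using assms by (rule borel_measurable_continuous_onI)
  show ?thesis unfolding self_similar_def by measurable
qed

lemma norm_div_sqrt: "0 < h \<Longrightarrow> norm (z /\<^sub>R sqrt h) = norm z / sqrt h"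
  by (simp add: divide_inverse)

text \<open>The Gaussian integral is \<open>(16 * pi * h) powr (DIM('a) / 2)\<close>, and its power
  of \<open>h\<close> cancels the normalization of the kernel. The factor \<open>D\<close> carries
  whatever gain a difference has.\<close>

lemma nn_integral_dilated_gaussian_le:
  fixes x :: "'a::euclidean_space" and q :: "'a \<Rightarrow> 'b::real_normed_vector"
  assumes h: "0 < h" and D: "0 \<le> D"
    and q: "\<And>y. norm (q y) \<le> D * (h powr (a - DIM('a) / 2) * exp (- ((norm ((x - y) /\<^sub>R sqrt h))\<^sup>2 / 16)))"
  shows "(\<integral>\<^sup>+y. ennreal (norm (q y)) \<partial>lborel) \<le> ennreal (D * ((16 * pi) powr (DIM('a) / 2) * h powr a))"
proof -
  have "(\<integral>\<^sup>+y. ennreal (norm (q y)) \<partial>lborel)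
      \<le> (\<integral>\<^sup>+y. ennreal (D * h powr (a - DIM('a) / 2)) * ennreal (exp (- (1 / (16 * h) * (norm (x - y))\<^sup>2))) \<partial>lborel)"
  proof (rule nn_integral_mono)
    fix y
    have "(norm ((x - y) /\<^sub>R sqrt h))\<^sup>2 / 16 = 1 / (16 * h) * (norm (x - y))\<^sup>2"
      using h by (simp add: norm_div_sqrt power_divide del: norm_scaleR)
    then show "ennreal (norm (q y)) \<le> ennreal (D * h powr (a - DIM('a) / 2)) * ennreal (exp (- (1 / (16 * h) * (norm (x - y))\<^sup>2)))"
      using q[of y] D by (simp only: ennreal_mult[symmetric] mult_nonneg_nonneg powr_ge_zero exp_ge_zero mult.assoc ennreal_leI)
  qed
  also have "\<dots> = ennreal (D * h powr (a - DIM('a) / 2)) * ennreal ((pi / (1 / (16 * h))) powr (DIM('a) / 2))"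
    using h by (subst nn_integral_cmult, simp, subst nn_integral_gaussian) auto
  also have "\<dots> = ennreal (D * h powr (a - DIM('a) / 2) * ((16 * pi) powr (DIM('a) / 2) * h powr (DIM('a) / 2)))"
    using h D by (subst ennreal_mult[symmetric]) (auto simp: powr_mult[symmetric] mult_ac)
  also have "D * h powr (a - DIM('a) / 2) * ((16 * pi) powr (DIM('a) / 2) * h powr (DIM('a) / 2))
     = D * ((16 * pi) powr (DIM('a) / 2) * (h powr (a - DIM('a) / 2) * h powr (DIM('a) / 2)))"
    by (simp only: mult_ac)
  also have "h powr (a - DIM('a) / 2) * h powr (DIM('a) / 2) = h powr a"
    by (simp flip: powr_add)
  finally show ?thesis .
qed

lemma powr_half_ratio: "0 < h \<Longrightarrow> ((norm e)\<^sup>2 / h) powr (1/2) = norm e / sqrt h"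
  by (simp add: powr_half_sqrt real_sqrt_divide)

text \<open>These are the only facts about a profile that the estimates in this locale use. In
  \<open>dilate_le\<close> the exponent is that of the kernel, since passing from \<open>h\<close>
  to \<open>\<sigma> * h\<close> rescales the argument and changes the prefactor together.
  \<open>a > -1\<close> is local integrability in time; \<open>a < 0\<close> makes the integral of
  time differences converge at infinity.\<close>

locale self_similar_kernel =
  fixes P :: "'a::euclidean_space \<Rightarrow> 'b::{banach, second_countable_topology}" and a B :: real
  assumes a: "-1 < a" "a < 0" and B: "0 \<le> B"
    and continuous: "continuous_on UNIV P"
    and profile_le: "norm (P \<zeta>) \<le> B * exp (- ((norm \<zeta>)\<^sup>2 / 16))"
    and shift_le: "norm \<eta> \<le> 1 \<Longrightarrow> norm (P (\<zeta> + \<eta>) - P \<zeta>) \<le> B * norm \<eta> * exp (- ((norm \<zeta>)\<^sup>2 / 16))"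
    and dilate_le: "1 \<le> \<sigma> \<Longrightarrow> \<sigma> \<le> 2 \<Longrightarrow>
      norm (\<sigma> powr (a - DIM('a) / 2) *\<^sub>R P (\<zeta> /\<^sub>R sqrt \<sigma>) - P \<zeta>) \<le> B * (\<sigma> - 1) * exp (- ((norm \<zeta>)\<^sup>2 / 16))"
begin

abbreviation "ker \<equiv> self_similar a P"

definition "A = B * (16 * pi) powr (DIM('a) / 2)"

lemma A_nonneg: "0 \<le> A"
  using B by (simp add: A_def)

lemma measurable_ker [measurable]: "(\<lambda>p. ker (x - fst p) (t - snd p)) \<in> borel_measurable borel"
  using continuous by (rule borel_measurable_self_similar)

lemma measurable_ker_slice [measurable]: "(\<lambda>y. ker (x - y) h) \<in> borel_measurable borel"
proof -
  have [measurable]: "P \<in> borel_measurable borel" using continuous by (rule borel_measurable_continuous_onI)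
  show ?thesis unfolding self_similar_def by measurable
qed

section \<open>Integrals of the kernel and its differences over one time slice\<close>

lemma slice_le:
  "(\<integral>\<^sup>+y. ennreal (norm (ker (x - y) h)) \<partial>lborel) \<le> ennreal (A * (h powr a * indicator {0<..} h))"
proof (cases "0 < h")
  case True
  have "(\<integral>\<^sup>+y. ennreal (norm (ker (x - y) h)) \<partial>lborel) \<le> ennreal (B * ((16 * pi) powr (DIM('a) / 2) * h powr a))"
  proof (rule nn_integral_dilated_gaussian_le[OF True B])
    fix y
    show "norm (ker (x - y) h) \<le> B * (h powr (a - DIM('a) / 2) * exp (- ((norm ((x - y) /\<^sub>R sqrt h))\<^sup>2 / 16)))"
      using mult_left_mono[OF profile_le[of "(x - y) /\<^sub>R sqrt h"], of "h powr (a - DIM('a) / 2)"] True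
      by (simp add: self_similar_def mult_ac)
  qed
  then show ?thesis using True by (simp add: A_def mult_ac)
qed (simp add: self_similar_def)

text \<open>The fallback below the parabolic scale, where a difference gains nothing. As
  \<open>a < 0\<close>, the later time has the smaller bound, so the earlier one serves for both
  terms. Shifts use it with \<open>h' = h\<close>, time steps with \<open>x' = x\<close>.\<close>

lemma slice_diff_triangle_le:
  assumes "0 < h" "h \<le> h'"
  shows "(\<integral>\<^sup>+y. ennreal (norm (ker (x' - y) h' - ker (x - y) h)) \<partial>lborel) \<le> ennreal (2 * A * h powr a)"
proof -
  have "(\<integral>\<^sup>+y. ennreal (norm (ker (x' - y) h' - ker (x - y) h)) \<partial>lborel)
      \<le> (\<integral>\<^sup>+y. ennreal (norm (ker (x' - y) h')) + ennreal (norm (ker (x - y) h)) \<partial>lborel)"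
    by (intro nn_integral_mono) (simp add: ennreal_plus[symmetric] ennreal_leI norm_triangle_ineq4 del: ennreal_plus)
  also have "\<dots> = (\<integral>\<^sup>+y. ennreal (norm (ker (x' - y) h')) \<partial>lborel) + (\<integral>\<^sup>+y. ennreal (norm (ker (x - y) h)) \<partial>lborel)"
    by (intro nn_integral_add) auto
  also have "\<dots> \<le> ennreal (A * h' powr a) + ennreal (A * h powr a)"
    using slice_le[of x' h'] slice_le[of x h] assms by (intro add_mono) (simp_all add: indicator_def)
  also have "\<dots> \<le> ennreal (A * h powr a) + ennreal (A * h powr a)"
    using a assms A_nonneg by (intro add_mono ennreal_leI mult_left_mono powr_mono2') auto
  also have "\<dots> = ennreal (2 * A * h powr a)"
    using A_nonneg by (simp flip: ennreal_plus)
  finally show ?thesis .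
qed

text \<open>Rescaling by \<open>sqrt h\<close> turns the shift into one of length
  \<open>norm (x' - x) / sqrt h\<close>, which \<open>shift_le\<close> accepts when the squared
  length is at most \<open>h\<close>. The gain is written as a power 1/2 to fit
  \<open>nn_integral_powr_min_le\<close>.\<close>

lemma slice_space_diff_le:
  "(\<integral>\<^sup>+y. ennreal (norm (ker (x' - y) h - ker (x - y) h)) \<partial>lborel)
     \<le> ennreal (2 * A * (h powr a * min 1 (((norm (x' - x))\<^sup>2 / h) powr (1/2)) * indicator {0<..} h))"
proof (cases "0 < h")
  case True
  define e where "e = x' - x"
  show ?thesis
  proof (cases "(norm e)\<^sup>2 \<le> h")
    case small: True
    have le1: "norm e / sqrt h \<le> 1"
      using small True real_le_rsqrt by auto
    have mn: "min 1 (((norm e)\<^sup>2 / h) powr (1/2)) = norm e / sqrt h"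
      unfolding powr_half_ratio[OF True] using le1 by (rule min_absorb2)
    have "(\<integral>\<^sup>+y. ennreal (norm (ker (x' - y) h - ker (x - y) h)) \<partial>lborel)
       \<le> ennreal ((B * (norm e / sqrt h)) * ((16 * pi) powr (DIM('a) / 2) * h powr a))"
    proof (rule nn_integral_dilated_gaussian_le[OF True])
      fix y
      define \<zeta> where "\<zeta> = (x - y) /\<^sub>R sqrt h"
      have "(x' - y) /\<^sub>R sqrt h = \<zeta> + e /\<^sub>R sqrt h"
        by (simp add: \<zeta>_def e_def flip: scaleR_add_right)
      then have "norm (ker (x' - y) h - ker (x - y) h) = h powr (a - DIM('a) / 2) * norm (P (\<zeta> + e /\<^sub>R sqrt h) - P \<zeta>)"
        using True by (simp add: self_similar_def \<zeta>_def[symmetric] flip: scaleR_diff_right)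
      also have "\<dots> \<le> h powr (a - DIM('a) / 2) * (B * norm (e /\<^sub>R sqrt h) * exp (- ((norm \<zeta>)\<^sup>2 / 16)))"
        using le1 True by (intro mult_left_mono shift_le) (auto simp: norm_div_sqrt simp del: norm_scaleR)
      finally show "norm (ker (x' - y) h - ker (x - y) h)
          \<le> B * (norm e / sqrt h) * (h powr (a - DIM('a) / 2) * exp (- ((norm ((x - y) /\<^sub>R sqrt h))\<^sup>2 / 16)))"
        unfolding \<zeta>_def[symmetric] norm_div_sqrt[OF True] by (simp only: mult_ac)
    qed (use B True in auto)
    also have "\<dots> \<le> ennreal (2 * A * (h powr a * (norm e / sqrt h)))"
    proof (rule ennreal_leI)
      have "B * (norm e / sqrt h) * ((16 * pi) powr (DIM('a) / 2) * h powr a) = A * (h powr a * (norm e / sqrt h))"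
        unfolding A_def by (simp only: mult_ac)
      moreover have "0 \<le> A * (h powr a * (norm e / sqrt h))" using A_nonneg True by simp
      ultimately show "B * (norm e / sqrt h) * ((16 * pi) powr (DIM('a) / 2) * h powr a) \<le> 2 * A * (h powr a * (norm e / sqrt h))"
        by linarith
    qed
    finally show ?thesis unfolding e_def[symmetric] mn using True by simp
  next
    case False
    then have "1 \<le> norm e / sqrt h"
      using True by (simp add: real_le_lsqrt)
    then show ?thesis using slice_diff_triangle_le[of h h x' x] True by (simp add: powr_half_ratio e_def[symmetric] min_def)
  qed
qed (simp add: self_similar_def)

text \<open>The first summand accounts for \<open>-d < h \<le> 0\<close>, where the earlier kernel
  vanishes and only the later one is left. For \<open>h > 0\<close> the step is a dilation by
  \<open>1 + d / h\<close>, within the range of \<open>dilate_le\<close> if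
  \<open>d \<le> h\<close>.\<close>

lemma slice_time_diff_le:
  assumes d: "0 < d"
  shows "(\<integral>\<^sup>+y. ennreal (norm (ker (x - y) (h + d) - ker (x - y) h)) \<partial>lborel)
     \<le> ennreal (A * ((h + d) powr a * indicator {0<..d} (h + d))) + ennreal (2 * A * (h powr a * min 1 ((d / h) powr 1) * indicator {0<..} h))"
proof (cases "0 < h")
  case True
  have "(\<integral>\<^sup>+y. ennreal (norm (ker (x - y) (h + d) - ker (x - y) h)) \<partial>lborel)
     \<le> ennreal (2 * A * (h powr a * min 1 ((d / h) powr 1) * indicator {0<..} h))"
  proof (cases "d \<le> h")
    case small: True
    have mn: "min 1 ((d / h) powr 1) = d / h"
      using small True d by (simp add: min_absorb2)
    define \<sigma> where "\<sigma> = 1 + d / h"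
    have \<sigma>: "1 \<le> \<sigma>" "\<sigma> \<le> 2" "h + d = \<sigma> * h" using small True d by (auto simp: \<sigma>_def field_simps)
    have "(\<integral>\<^sup>+y. ennreal (norm (ker (x - y) (h + d) - ker (x - y) h)) \<partial>lborel)
       \<le> ennreal ((B * (\<sigma> - 1)) * ((16 * pi) powr (DIM('a) / 2) * h powr a))"
    proof (rule nn_integral_dilated_gaussian_le[OF True])
      fix y
      define \<zeta> where "\<zeta> = (x - y) /\<^sub>R sqrt h"
      have "(x - y) /\<^sub>R sqrt (h + d) = \<zeta> /\<^sub>R sqrt \<sigma>"
        by (simp add: \<sigma>(3) \<zeta>_def real_sqrt_mult)
      moreover have "(h + d) powr (a - DIM('a) / 2) = h powr (a - DIM('a) / 2) * \<sigma> powr (a - DIM('a) / 2)"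
        using \<sigma> True by (simp add: powr_mult)
      ultimately have "ker (x - y) (h + d) - ker (x - y) h
          = h powr (a - DIM('a) / 2) *\<^sub>R (\<sigma> powr (a - DIM('a) / 2) *\<^sub>R P (\<zeta> /\<^sub>R sqrt \<sigma>) - P \<zeta>)"
        using True d unfolding self_similar_def \<zeta>_def[symmetric]
        by (simp only: if_True add_pos_pos scaleR_diff_right scaleR_scaleR)
      then have "norm (ker (x - y) (h + d) - ker (x - y) h)
          = h powr (a - DIM('a) / 2) * norm (\<sigma> powr (a - DIM('a) / 2) *\<^sub>R P (\<zeta> /\<^sub>R sqrt \<sigma>) - P \<zeta>)"
        by simp
      also have "\<dots> \<le> h powr (a - DIM('a) / 2) * (B * (\<sigma> - 1) * exp (- ((norm \<zeta>)\<^sup>2 / 16)))"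
        using \<sigma> by (intro mult_left_mono dilate_le) auto
      finally show "norm (ker (x - y) (h + d) - ker (x - y) h)
          \<le> B * (\<sigma> - 1) * (h powr (a - DIM('a) / 2) * exp (- ((norm ((x - y) /\<^sub>R sqrt h))\<^sup>2 / 16)))"
        by (simp add: \<zeta>_def[symmetric] mult_ac)
    qed (use B \<sigma> in auto)
    also have "\<dots> \<le> ennreal (2 * A * (h powr a * (d / h)))"
    proof (rule ennreal_leI)
      have "B * (\<sigma> - 1) * ((16 * pi) powr (DIM('a) / 2) * h powr a) = A * (h powr a * (d / h))"
        unfolding A_def \<sigma>_def by (simp only: mult_ac add_diff_cancel_left')
      moreover have "0 \<le> A * (h powr a * (d / h))" using A_nonneg True d by simp
      ultimately show "B * (\<sigma> - 1) * ((16 * pi) powr (DIM('a) / 2) * h powr a) \<le> 2 * A * (h powr a * (d / h))"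
        by linarith
    qed
    finally show ?thesis unfolding mn using True by simp
  next
    case False
    then show ?thesis using slice_diff_triangle_le[of h "h + d" x x] True d by (simp add: min_def)
  qed
  then show ?thesis by (rule order.trans) simp
next
  case False
  then have "ker (x - y) h = 0" for y by (simp add: self_similar_def)
  then have "(\<integral>\<^sup>+y. ennreal (norm (ker (x - y) (h + d) - ker (x - y) h)) \<partial>lborel) \<le> ennreal (A * ((h + d) powr a * indicator {0<..} (h + d)))"
    using slice_le[of x "h + d"] by simp
  then show ?thesis using False by (simp add: indicator_def)
qed

end

section \<open>The borderline logarithmic integral\<close>

lemma ln_min_half_bounds:
  fixes r :: real
  assumes "0 < r"
  shows "1/2 \<le> \<bar>ln (min r (1/2))\<bar>" and "- ln r \<le> \<bar>ln (min r (1/2))\<bar>"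
proof -
  have m: "0 < min r (1/2)" "min r (1/2) \<le> 1/2" "min r (1/2) \<le> r" using assms by auto
  \<comment> \<open>The sharp bound is \<open>- ln 2\<close>; the elementary one is enough to absorb
    additive constants into the logarithm.\<close>
  have "ln (min r (1/2)) \<le> -1/2" using ln_le_minus_one[OF m(1)] m(2) by simp
  moreover have "ln (min r (1/2)) \<le> ln r" using m assms by (subst ln_le_cancel_iff) auto
  ultimately show "1/2 \<le> \<bar>ln (min r (1/2))\<bar>" "- ln r \<le> \<bar>ln (min r (1/2))\<bar>" by auto
qed

text \<open>At exponent -1/2 the integrand beyond \<open>r\<^sup>2\<close> is \<open>r / h\<close>,
  so a cut-off is indispensable. The value 5 is the range of elapsed times from source times above
  -4 to times below 1, and \<open>r < 2\<close> places \<open>r\<^sup>2\<close> below it.\<close>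

lemma nn_integral_log_le:
  fixes r :: real
  assumes r: "0 < r" "r < 2"
  shows "(\<integral>\<^sup>+h. ennreal (h powr (-1/2) * min 1 ((r\<^sup>2 / h) powr (1/2)) * indicator {0<..<5} h) \<partial>lborel)
    \<le> ennreal (14 * (r * \<bar>ln (min r (1/2))\<bar>))"
proof -
  have r2: "0 < r\<^sup>2" "r\<^sup>2 \<le> 5" "0 \<le> r\<^sup>2" "r powr 1 = r"
    using r power_strict_mono[of r 2 2] by auto
  have "(\<integral>\<^sup>+h. ennreal (h powr (-1/2) * min 1 ((r\<^sup>2 / h) powr (1/2)) * indicator {0<..<5} h) \<partial>lborel)
    \<le> (\<integral>\<^sup>+h. ennreal (h powr (-1/2) * indicator {0..r\<^sup>2} h) + ennreal r * ennreal (1 / h * indicator {r\<^sup>2..5} h) \<partial>lborel)"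
  proof (rule nn_integral_mono)
    fix h :: real
    have 1: "h powr (-1/2) * min 1 ((r\<^sup>2 / h) powr (1/2)) \<le> h powr (-1/2)"
      by (intro mult_left_le) auto
    have 2: "h powr (-1/2) * min 1 ((r\<^sup>2 / h) powr (1/2)) \<le> r * (1 / h)" if "0 < h"
    proof -
      have "h powr (-1/2) * min 1 ((r\<^sup>2 / h) powr (1/2)) \<le> h powr (-1/2) * (r\<^sup>2 / h) powr (1/2)"
        by (intro mult_left_mono) auto
      also have "\<dots> = r * (1 / h)"
      proof -
        have "(r\<^sup>2 / h) powr (1/2) = r / sqrt h"
          using powr_half_ratio[OF that, of r] r by simp
        moreover have "h powr (-1/2) = 1 / sqrt h"
          using that by (simp add: powr_half_sqrt[symmetric] powr_minus_divide)
        ultimately show ?thesis using that by simp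
      qed
      finally show ?thesis .
    qed
    show "ennreal (h powr (-1/2) * min 1 ((r\<^sup>2 / h) powr (1/2)) * indicator {0<..<5} h)
       \<le> ennreal (h powr (-1/2) * indicator {0..r\<^sup>2} h) + ennreal r * ennreal (1 / h * indicator {r\<^sup>2..5} h)"
    proof (cases "0 < h \<and> h < 5")
      case True
      show ?thesis
      proof (cases "h \<le> r\<^sup>2")
        case le: True
        have "ennreal (h powr (-1/2) * min 1 ((r\<^sup>2 / h) powr (1/2))) \<le> ennreal (h powr (-1/2))"
          using 1 by (rule ennreal_leI)
        also have "\<dots> \<le> ennreal (h powr (-1/2)) + ennreal r * ennreal (1 / h * indicator {r\<^sup>2..5} h)" by simp
        finally show ?thesis using True le by simp
      next
        case False
        have "ennreal (h powr (-1/2) * min 1 ((r\<^sup>2 / h) powr (1/2))) \<le> ennreal r * ennreal (1 / h)"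
          using 2 True r by (subst ennreal_mult'[symmetric]) (auto intro: ennreal_leI)
        then show ?thesis using True False by simp
      qed
    next
      case False
      then have "indicator {0<..<5} h = (0::real)" by auto
      then show ?thesis by simp
    qed
  qed
  also have "\<dots> = ennreal ((r\<^sup>2) powr (-1/2 + 1) / (-1/2 + 1)) + ennreal r * ennreal (ln 5 - ln (r\<^sup>2))"
    using r2 by (subst nn_integral_add, simp, simp, subst nn_integral_cmult, simp)
      (simp only: nn_integral_powr_from_0 nn_integral_inverse_interval)
  also have "\<dots> = ennreal (2 * r + r * (ln 5 - 2 * ln r))"
  proof -
    have "(r\<^sup>2) powr (-1/2 + 1) = r" using r by (simp add: powr_half_sqrt)
    moreover have "ln (r\<^sup>2) = 2 * ln r" using r by (simp add: ln_realpow)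
    moreover have "2 * ln r \<le> ln 5" using r r2 \<open>ln (r\<^sup>2) = 2 * ln r\<close> by (metis ln_mono)
    ultimately show ?thesis using r by (simp flip: ennreal_mult' ennreal_plus)
  qed
  also have "\<dots> \<le> ennreal (14 * (r * \<bar>ln (min r (1/2))\<bar>))"
  proof (rule ennreal_leI)
    define L where "L = \<bar>ln (min r (1/2))\<bar>"
    \<comment> \<open>Since \<open>L \<ge> 1/2\<close>, the constant \<open>2 + ln 5 \<le> 6\<close>
      is at most \<open>12 * L\<close>; together with \<open>- 2 * ln r \<le> 2 * L\<close> this
      gives 14.\<close>
    have "ln 5 \<le> (4::real)" using ln_le_minus_one[of "5::real"] by simp
    then have "2 + (ln 5 - 2 * ln r) \<le> 14 * L"
      using ln_min_half_bounds[OF r(1)] unfolding L_def[symmetric] by linarith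
    then have "r * (2 + (ln 5 - 2 * ln r)) \<le> r * (14 * L)"
      using r by (intro mult_left_mono) auto
    then show "2 * r + r * (ln 5 - 2 * ln r) \<le> 14 * (r * L)"
      by (simp add: algebra_simps)
  qed
  finally show ?thesis .
qed

text \<open>Change of variable from the source time \<open>\<tau>\<close> to the elapsed time
  \<open>h = t - \<tau>\<close>, in which the power integrals are stated.\<close>

lemma nn_integral_scaled_le:
  fixes f :: "real \<Rightarrow> real" and c I :: real
  assumes "f \<in> borel_measurable borel" "(\<integral>\<^sup>+h. ennreal (f h) \<partial>lborel) \<le> ennreal I" "0 \<le> c"
  shows "(\<integral>\<^sup>+\<tau>. ennreal (c * f (t - \<tau>)) \<partial>lborel) \<le> ennreal (c * I)"
proof -
  have [measurable]: "f \<in> borel_measurable borel" by fact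
  have "(\<integral>\<^sup>+\<tau>. ennreal (c * f (t - \<tau>)) \<partial>lborel) = (\<integral>\<^sup>+h. ennreal (c * f h) \<partial>lborel)"
    by (rule nn_integral_reflect[where \<psi> = "\<lambda>h. ennreal (c * f h)"]) measurable
  also have "\<dots> = ennreal c * (\<integral>\<^sup>+h. ennreal (f h) \<partial>lborel)"
    unfolding ennreal_mult'[OF assms(3)] by (rule nn_integral_cmult) measurable
  also have "\<dots> \<le> ennreal (c * I)"
    unfolding ennreal_mult'[OF assms(3)] by (intro mult_left_mono assms) auto
  finally show ?thesis .
qed

context self_similar_kernel
begin

section \<open>Integration in time: size and regularity of the potential\<close>

lemma potential_aux:
  assumes g: "bounded_source g M"
  shows integrable_potential: "integrable lborel (\<lambda>p. g p *\<^sub>R ker (x - fst p) (t - snd p))" (is ?I)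
    and potential_le: "norm (potential ker g x t) \<le> M * (A * (max 0 (t + 4) powr (a + 1) / (a + 1)))" (is ?N)
proof -
  \<comment> \<open>Source times exceed -4, so elapsed times stay below \<open>t + 4\<close>; the
    maximum with 0 covers \<open>t \<le> -4\<close>, where the bound becomes 0.\<close>
  define T where "T = max 0 (t + 4)"
  have T: "0 \<le> T" by (simp add: T_def)
  let ?F = "\<lambda>\<tau>. ennreal (A * ((t - \<tau>) powr a * indicator {0<..} (t - \<tau>)))"
  have "(\<integral>\<^sup>+\<tau>. ?F \<tau> * indicator {-4<..<4} \<tau> \<partial>lborel)
      \<le> (\<integral>\<^sup>+\<tau>. ennreal (A * ((t - \<tau>) powr a * indicator {0..T} (t - \<tau>))) \<partial>lborel)"
    by (rule nn_integral_mono) (auto simp: indicator_def T_def)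
  also have "\<dots> \<le> ennreal (A * (T powr (a + 1) / (a + 1)))"
    by (rule nn_integral_scaled_le[where f = "\<lambda>h. h powr a * indicator {0..T} h"])
      (use a T A_nonneg in \<open>auto simp: nn_integral_powr_from_0\<close>)
  finally have I: "(\<integral>\<^sup>+\<tau>. ?F \<tau> * indicator {-4<..<4} \<tau> \<partial>lborel) \<le> ennreal (A * (T powr (a + 1) / (a + 1)))" .
  have 0: "0 \<le> A * (T powr (a + 1) / (a + 1))" using A_nonneg a by simp
  have F: "(\<integral>\<^sup>+y. ennreal (norm (ker (x - fst (y, \<tau>)) (t - snd (y, \<tau>)))) \<partial>lborel) \<le> ?F \<tau>" for \<tau>
    using slice_le[of x "t - \<tau>"] by simp
  note * = integral_source_le[OF g measurable_ker F I 0]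
  show ?I by (rule *)
  show ?N using *(2) by (simp add: potential_def T_def)
qed

lemma potential_diff_eq:
  assumes g: "bounded_source g M"
  shows "potential ker g x' t' - potential ker g x t
     = (\<integral>p. g p *\<^sub>R (ker (x' - fst p) (t' - snd p) - ker (x - fst p) (t - snd p)) \<partial>lborel)"
  unfolding potential_def scaleR_diff_right
  by (rule Bochner_Integration.integral_diff[symmetric]) (rule integrable_potential[OF g])+

text \<open>The time integral stays a hypothesis because the power and the logarithmic case evaluate
  it differently. The window inherited from the support of the source is retained, as the borderline
  integral is infinite without it.\<close>

lemma potential_space_diff_aux:
  assumes g: "bounded_source g M" and I: "0 \<le> I"
    "(\<integral>\<^sup>+h. ennreal (h powr a * min 1 (((norm (x' - x))\<^sup>2 / h) powr (1/2)) * indicator ({0<..} \<inter> {t - 4<..<t + 4}) h) \<partial>lborel) \<le> ennreal I"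
  shows "norm (potential ker g x' t - potential ker g x t) \<le> M * (2 * A * I)"
  unfolding potential_diff_eq[OF g]
proof (rule integral_source_le(2)[OF g])
  let ?f = "\<lambda>h. h powr a * min 1 (((norm (x' - x))\<^sup>2 / h) powr (1/2)) * indicator {0<..} h"
  show "(\<integral>\<^sup>+y. ennreal (norm (ker (x' - fst (y, \<tau>)) (t - snd (y, \<tau>)) - ker (x - fst (y, \<tau>)) (t - snd (y, \<tau>)))) \<partial>lborel)
     \<le> ennreal (2 * A * ?f (t - \<tau>))" for \<tau>
    using slice_space_diff_le[of x' "t - \<tau>" x] by simp
  have "(\<integral>\<^sup>+\<tau>. ennreal (2 * A * ?f (t - \<tau>)) * indicator {-4<..<4} \<tau> \<partial>lborel)
     \<le> (\<integral>\<^sup>+\<tau>. ennreal (2 * A * ((t - \<tau>) powr a * min 1 (((norm (x' - x))\<^sup>2 / (t - \<tau>)) powr (1/2)) * indicator ({0<..} \<inter> {t - 4<..<t + 4}) (t - \<tau>))) \<partial>lborel)"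
    by (rule nn_integral_mono) (auto simp: indicator_def)
  also have "\<dots> \<le> ennreal (2 * A * I)"
    by (rule nn_integral_scaled_le[where f = "\<lambda>h. h powr a * min 1 (((norm (x' - x))\<^sup>2 / h) powr (1/2)) * indicator ({0<..} \<inter> {t - 4<..<t + 4}) h"])
      (use I A_nonneg in auto)
  finally show "(\<integral>\<^sup>+\<tau>. ennreal (2 * A * ?f (t - \<tau>)) * indicator {-4<..<4} \<tau> \<partial>lborel) \<le> ennreal (2 * A * I)" .
  show "0 \<le> 2 * A * I" using A_nonneg I by simp
qed measurable

text \<open>\<open>a < -1/2\<close> is the tail condition for \<open>\<delta> = 1/2\<close>. It
  permits integration over the whole half-line, so the bound holds at all times.\<close>

lemma potential_space_holder:
  assumes g: "bounded_source g M" and a': "a < -1/2"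
  shows "norm (potential ker g x' t - potential ker g x t)
    \<le> M * (2 * A * (1 / (a + 1) + 1 / (1/2 - a - 1))) * norm (x' - x) powr (2 * (a + 1))"
proof (cases "x' = x")
  case False
  define r where "r = norm (x' - x)"
  have r: "0 < r" using False by (simp add: r_def)
  define I where "I = (1 / (a + 1) + 1 / (1/2 - a - 1)) * (r\<^sup>2) powr (a + 1)"
  have I0: "0 \<le> I" using a a' by (simp add: I_def)
  have "(\<integral>\<^sup>+h. ennreal (h powr a * min 1 ((r\<^sup>2 / h) powr (1/2)) * indicator ({0<..} \<inter> {t - 4<..<t + 4}) h) \<partial>lborel)
    \<le> (\<integral>\<^sup>+h. ennreal (h powr a * min 1 ((r\<^sup>2 / h) powr (1/2)) * indicator {0<..} h) \<partial>lborel)"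
    by (rule nn_integral_mono) (auto simp: indicator_def)
  also have "\<dots> \<le> ennreal I"
    unfolding I_def using a a' r by (intro nn_integral_powr_min_le) auto
  finally have "norm (potential ker g x' t - potential ker g x t) \<le> M * (2 * A * I)"
    unfolding r_def by (rule potential_space_diff_aux[OF g I0])
  also have "(r\<^sup>2) powr (a + 1) = r powr (2 * (a + 1))"
  proof -
    have "r\<^sup>2 = r powr 2" using r by simp
    then show ?thesis by (simp only: powr_powr)
  qed
  then have "M * (2 * A * I) = M * (2 * A * (1 / (a + 1) + 1 / (1/2 - a - 1))) * r powr (2 * (a + 1))"
    by (simp only: I_def mult.assoc)
  finally show ?thesis by (simp only: r_def)
qed simp

text \<open>\<open>t < 1\<close> keeps the window below 5, where the logarithmic integral applies;
  28 is twice its constant 14.\<close>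

lemma potential_space_log_lipschitz:
  assumes g: "bounded_source g M" and a': "a = -1/2" and x: "x \<noteq> x'" "norm (x' - x) < 2" and t: "t < 1"
  shows "norm (potential ker g x' t - potential ker g x t)
    \<le> M * (28 * A) * (norm (x' - x) * \<bar>ln (min (norm (x' - x)) (1/2))\<bar>)"
proof -
  define r where "r = norm (x' - x)"
  have r: "0 < r" "r < 2" using x by (auto simp: r_def)
  define I where "I = 14 * (r * \<bar>ln (min r (1/2))\<bar>)"
  have I0: "0 \<le> I" unfolding I_def using r by (intro mult_nonneg_nonneg abs_ge_zero) auto
  have "(\<integral>\<^sup>+h. ennreal (h powr a * min 1 ((r\<^sup>2 / h) powr (1/2)) * indicator ({0<..} \<inter> {t - 4<..<t + 4}) h) \<partial>lborel)
    \<le> (\<integral>\<^sup>+h. ennreal (h powr (-1/2) * min 1 ((r\<^sup>2 / h) powr (1/2)) * indicator {0<..<5} h) \<partial>lborel)"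
    by (rule nn_integral_mono) (use t a' in \<open>auto simp: indicator_def\<close>)
  also have "\<dots> \<le> ennreal I"
    unfolding I_def by (rule nn_integral_log_le[OF r])
  finally have "norm (potential ker g x' t - potential ker g x t) \<le> M * (2 * A * I)"
    unfolding r_def by (rule potential_space_diff_aux[OF g I0])
  also have "M * (2 * A * I) = M * (28 * A) * (r * \<bar>ln (min r (1/2))\<bar>)"
    by (simp add: I_def)
  finally show ?thesis by (simp only: r_def)
qed

text \<open>Source times within \<open>d = t' - t\<close> before \<open>t'\<close> are seen by the
  later kernel only and contribute \<open>1 / (a + 1)\<close>. The earlier ones lead to the power
  integral with \<open>\<delta> = 1\<close>, which is \<open>1 / (a + 1) + 1 / (- a)\<close> and
  enters with factor 2.\<close>

lemma potential_time_holder_less: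
  assumes g: "bounded_source g M" and t: "t < t'"
  shows "norm (potential ker g x t' - potential ker g x t)
    \<le> M * (A * (3 / (a + 1) + 2 / (- a))) * (t' - t) powr (a + 1)"
proof -
  define d where "d = t' - t"
  have d: "0 < d" using t by (simp add: d_def)
  let ?f1 = "\<lambda>h. h powr a * indicator {0..d} h"
  let ?f2 = "\<lambda>h. h powr a * min 1 ((d / h) powr 1) * indicator {0<..} h"
  let ?F = "\<lambda>\<tau>. ennreal (A * ?f1 (t' - \<tau>)) + ennreal (2 * A * ?f2 (t - \<tau>))"
  define I where "I = A * (d powr (a + 1) / (a + 1)) + 2 * A * ((1 / (a + 1) + 1 / (1 - a - 1)) * d powr (a + 1))"
  have e: "1 - a - 1 = - a" by simp
  have c: "0 \<le> 1 / (a + 1) + 1 / (1 - a - 1)"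
    unfolding e by (rule add_nonneg_nonneg) (use a in auto)
  have "norm (potential ker g x t' - potential ker g x t) \<le> M * I"
    unfolding potential_diff_eq[OF g]
  proof (rule integral_source_le(2)[OF g])
    show "(\<integral>\<^sup>+y. ennreal (norm (ker (x - fst (y, \<tau>)) (t' - snd (y, \<tau>)) - ker (x - fst (y, \<tau>)) (t - snd (y, \<tau>)))) \<partial>lborel)
       \<le> ?F \<tau>" for \<tau>
    proof -
      have e: "t - \<tau> + d = t' - \<tau>" by (simp add: d_def)
      have "(\<integral>\<^sup>+y. ennreal (norm (ker (x - y) (t' - \<tau>) - ker (x - y) (t - \<tau>))) \<partial>lborel)
         \<le> ennreal (A * ((t' - \<tau>) powr a * indicator {0<..d} (t' - \<tau>))) + ennreal (2 * A * ?f2 (t - \<tau>))"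
        using slice_time_diff_le[OF d, of x "t - \<tau>"] unfolding e .
      also have "\<dots> \<le> ?F \<tau>"
        using A_nonneg by (intro add_right_mono ennreal_leI mult_left_mono) (auto simp: indicator_def)
      finally show ?thesis by simp
    qed
    have "(\<integral>\<^sup>+\<tau>. ?F \<tau> * indicator {-4<..<4} \<tau> \<partial>lborel) \<le> (\<integral>\<^sup>+\<tau>. ?F \<tau> \<partial>lborel)"
      by (rule nn_integral_mono) (auto simp: indicator_def)
    also have "\<dots> = (\<integral>\<^sup>+\<tau>. ennreal (A * ?f1 (t' - \<tau>)) \<partial>lborel) + (\<integral>\<^sup>+\<tau>. ennreal (2 * A * ?f2 (t - \<tau>)) \<partial>lborel)"
      by (rule nn_integral_add) measurable
    also have "\<dots> \<le> ennreal (A * (d powr (a + 1) / (a + 1))) + ennreal (2 * A * ((1 / (a + 1) + 1 / (1 - a - 1)) * d powr (a + 1)))"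
    proof (rule add_mono)
      show "(\<integral>\<^sup>+\<tau>. ennreal (A * ?f1 (t' - \<tau>)) \<partial>lborel) \<le> ennreal (A * (d powr (a + 1) / (a + 1)))"
        by (rule nn_integral_scaled_le[where f = ?f1]) (use a d A_nonneg in \<open>auto simp: nn_integral_powr_from_0\<close>)
      show "(\<integral>\<^sup>+\<tau>. ennreal (2 * A * ?f2 (t - \<tau>)) \<partial>lborel) \<le> ennreal (2 * A * ((1 / (a + 1) + 1 / (1 - a - 1)) * d powr (a + 1)))"
      proof (rule nn_integral_scaled_le[where f = ?f2])
        show "(\<integral>\<^sup>+h. ennreal (?f2 h) \<partial>lborel) \<le> ennreal ((1 / (a + 1) + 1 / (1 - a - 1)) * d powr (a + 1))"
          using a d by (intro nn_integral_powr_min_le) auto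
      qed (use A_nonneg in auto)
    qed
    also have "\<dots> = ennreal I"
      unfolding I_def using a A_nonneg by (intro ennreal_plus[symmetric] mult_nonneg_nonneg c) auto
    finally show "(\<integral>\<^sup>+\<tau>. ?F \<tau> * indicator {-4<..<4} \<tau> \<partial>lborel) \<le> ennreal I" .
    show "0 \<le> I" unfolding I_def using a A_nonneg by (intro add_nonneg_nonneg mult_nonneg_nonneg c) auto
  qed measurable
  also have "M * I = M * (A * (3 / (a + 1) + 2 / (- a))) * d powr (a + 1)"
  proof -
    have "A * (q * u) + 2 * A * ((u + v) * q) = A * (3 * u + 2 * v) * q" for q u v :: real
      by algebra
    from this[of "d powr (a + 1)" "inverse (a + 1)" "inverse (- a)"]
    show ?thesis unfolding I_def e by (simp only: divide_inverse mult_1_left mult.assoc)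
  qed
  finally show ?thesis by (simp only: d_def)
qed

lemma potential_time_holder:
  assumes g: "bounded_source g M"
  shows "norm (potential ker g x t' - potential ker g x t)
    \<le> M * (A * (3 / (a + 1) + 2 / (- a))) * \<bar>t' - t\<bar> powr (a + 1)"
proof (cases t' t rule: linorder_cases)
  case less
  then show ?thesis using potential_time_holder_less[OF g less, of x] by (simp add: norm_minus_commute)
next
  case greater
  then show ?thesis using potential_time_holder_less[OF g greater, of x] by simp
qed simp

end

section \<open>The heat kernel and its gradient\<close>

text \<open>The constant is \<open>1024 * (p + 1)\<close>, where \<open>- p\<close> is the exponent
  in the dilation bound; as \<open>p \<ge> 0\<close>, it dominates the constants of all three
  profile estimates.\<close>

lemma self_similar_kernel_gauss_profile:
  assumes s: "0 < s" "s < 1"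
  shows "self_similar_kernel (gauss_profile :: 'a::euclidean_space \<Rightarrow> real) (s - 1) (1024 * (DIM('a) / 2 + 2 - s))"
proof
  let ?B = "1024 * (DIM('a) / 2 + 2 - s)"
  have B: "1024 \<le> ?B" using s by simp
  then show "0 \<le> ?B" by simp
  show "-1 < s - 1" "s - 1 < 0" using s by auto
  show "continuous_on UNIV (gauss_profile :: 'a \<Rightarrow> real)" by (rule continuous_on_gauss_profile)
  fix \<zeta> \<eta> :: 'a and \<sigma> :: real
  show "norm (gauss_profile \<zeta>) \<le> ?B * exp (- ((norm \<zeta>)\<^sup>2 / 16))"
    using B by (intro order.trans[OF gauss_profile_le] mult_right_mono) auto
  show "norm (gauss_profile (\<zeta> + \<eta>) - gauss_profile \<zeta>) \<le> ?B * norm \<eta> * exp (- ((norm \<zeta>)\<^sup>2 / 16))"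
    if "norm \<eta> \<le> 1"
    using B by (intro order.trans[OF gauss_profile_diff_le[OF that]] mult_right_mono) auto
  show "norm (\<sigma> powr (s - 1 - DIM('a) / 2) *\<^sub>R gauss_profile (\<zeta> /\<^sub>R sqrt \<sigma>) - gauss_profile \<zeta>)
      \<le> ?B * (\<sigma> - 1) * exp (- ((norm \<zeta>)\<^sup>2 / 16))" if l: "1 \<le> \<sigma>" "\<sigma> \<le> 2"
  proof -
    define p where "p = DIM('a) / 2 + 1 - s"
    have p: "0 \<le> p" "s - 1 - DIM('a) / 2 = - p" "512 * (p + 1) \<le> ?B" using s by (auto simp: p_def)
    show ?thesis
      unfolding p(2) using p l by (intro order.trans[OF gauss_profile_dilate_le[OF p(1) l]] mult_right_mono) auto
  qed
qed

text \<open>A spatial derivative costs \<open>1 / sqrt h\<close>, which lowers the exponent by 1/2;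
  \<open>s > 1/2\<close> is what keeps it above -1. The constant is \<open>1024 * (p + 2)\<close>
  for the corresponding \<open>p\<close>.\<close>

lemma self_similar_kernel_grad_profile:
  assumes s: "1/2 < s" "s < 1"
  shows "self_similar_kernel (grad_profile :: 'a::euclidean_space \<Rightarrow> 'a) (s - 3/2) (1024 * (DIM('a) / 2 + 7/2 - s))"
proof
  let ?B = "1024 * (DIM('a) / 2 + 7/2 - s)"
  have B: "1024 \<le> ?B" using s by simp
  then show "0 \<le> ?B" by simp
  show "-1 < s - 3/2" "s - 3/2 < 0" using s by auto
  show "continuous_on UNIV (grad_profile :: 'a \<Rightarrow> 'a)" by (rule continuous_on_grad_profile)
  fix \<zeta> \<eta> :: 'a and \<sigma> :: real
  show "norm (grad_profile \<zeta>) \<le> ?B * exp (- ((norm \<zeta>)\<^sup>2 / 16))"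
    using B by (intro order.trans[OF grad_profile_le] mult_right_mono) auto
  show "norm (grad_profile (\<zeta> + \<eta>) - grad_profile \<zeta>) \<le> ?B * norm \<eta> * exp (- ((norm \<zeta>)\<^sup>2 / 16))"
    if "norm \<eta> \<le> 1"
    using B by (intro order.trans[OF grad_profile_diff_le[OF that]] mult_right_mono) auto
  show "norm (\<sigma> powr (s - 3/2 - DIM('a) / 2) *\<^sub>R grad_profile (\<zeta> /\<^sub>R sqrt \<sigma>) - grad_profile \<zeta>)
      \<le> ?B * (\<sigma> - 1) * exp (- ((norm \<zeta>)\<^sup>2 / 16))" if l: "1 \<le> \<sigma>" "\<sigma> \<le> 2"
  proof -
    define p where "p = DIM('a) / 2 + 3/2 - s"
    have p: "0 \<le> p" "s - 3/2 - DIM('a) / 2 = - p" "512 * (p + 2) \<le> ?B" using s by (auto simp: p_def)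
    show ?thesis
      unfolding p(2) using p l by (intro order.trans[OF grad_profile_dilate_le[OF p(1) l]] mult_right_mono) auto
  qed
qed

text \<open>The normalizing constant is left out here; later the source carries it.\<close>

abbreviation heat_kernel :: "real \<Rightarrow> 'a::euclidean_space \<Rightarrow> real \<Rightarrow> real" where
  "heat_kernel s \<equiv> self_similar (s - 1) gauss_profile"

abbreviation grad_kernel :: "real \<Rightarrow> 'a::euclidean_space \<Rightarrow> real \<Rightarrow> 'a" where
  "grad_kernel s \<equiv> self_similar (s - 3/2) grad_profile"

text \<open>The remainder is \<open>norm (x' - x)\<close> times a bound of the type that the
  gradient kernel has under a shift, so the power integral with exponent \<open>s - 3/2\<close>
  applies again. Above the parabolic scale this is the Taylor bound of the profile. Below it the
  kernel difference and the linear term are estimated separately, and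
  \<open>sqrt h \<le> norm (x' - x)\<close> trades half a power of \<open>h\<close> for a factor of
  the shift.\<close>

lemma slice_taylor_le:
  assumes s: "1/2 < s" "s < 1"
  shows "\<exists>D\<ge>0. \<forall>(x::'a::euclidean_space) x' h.
    (\<integral>\<^sup>+y. ennreal (norm (heat_kernel s (x' - y) h - heat_kernel s (x - y) h - (x' - x) \<bullet> grad_kernel s (x - y) h)) \<partial>lborel)
     \<le> ennreal (D * norm (x' - x) * (h powr (s - 3/2) * min 1 (((norm (x' - x))\<^sup>2 / h) powr (1/2)) * indicator {0<..} h))"
proof -
  interpret U: self_similar_kernel "gauss_profile :: 'a \<Rightarrow> real" "s - 1" "1024 * (DIM('a) / 2 + 2 - s)"
    using s by (intro self_similar_kernel_gauss_profile) auto
  interpret V: self_similar_kernel "grad_profile :: 'a \<Rightarrow> 'a" "s - 3/2" "1024 * (DIM('a) / 2 + 7/2 - s)"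
    using s by (intro self_similar_kernel_grad_profile) auto
  define G where "G = (16 * pi) powr (DIM('a) / 2)"
  define D where "D = 768 * G + 2 * U.A + V.A"
  have G: "0 \<le> G" by (simp add: G_def)
  have D: "0 \<le> D" "768 * G \<le> D" "2 * U.A + V.A \<le> D"
    using G U.A_nonneg V.A_nonneg by (auto simp: D_def)
  have "(\<integral>\<^sup>+y. ennreal (norm (heat_kernel s (x' - y) h - heat_kernel s (x - y) h - (x' - x) \<bullet> grad_kernel s (x - y) h)) \<partial>lborel)
     \<le> ennreal (D * norm (x' - x) * (h powr (s - 3/2) * min 1 (((norm (x' - x))\<^sup>2 / h) powr (1/2)) * indicator {0<..} h))"
    for x x' :: 'a and h :: real
  proof (cases "0 < h")
    case h: True
    define e where "e = x' - x"
    \<comment> \<open>The half power between the two kernels: \<open>b\<close> is half the dimension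
      for pointwise values and 0 for slice integrals.\<close>
    have split: "h powr (s - 1 - b) = h powr (s - 3/2 - b) * sqrt h" for b
    proof -
      have "h powr (s - 1 - b) = h powr ((s - 3/2 - b) + 1/2)" by (simp add: algebra_simps)
      also have "\<dots> = h powr (s - 3/2 - b) * sqrt h" using h by (simp only: powr_add powr_half_sqrt)
      finally show ?thesis .
    qed
    have bound: "(\<integral>\<^sup>+y. ennreal (norm (heat_kernel s (x' - y) h - heat_kernel s (x - y) h - e \<bullet> grad_kernel s (x - y) h)) \<partial>lborel)
     \<le> ennreal (D * norm e * (h powr (s - 3/2) * m))" if m: "m = min 1 (norm e / sqrt h)" for m
    proof (cases "(norm e)\<^sup>2 \<le> h")
      case small: True
      have le1: "norm e / sqrt h \<le> 1"
        using small h real_le_rsqrt by auto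
      have "(\<integral>\<^sup>+y. ennreal (norm (heat_kernel s (x' - y) h - heat_kernel s (x - y) h - e \<bullet> grad_kernel s (x - y) h)) \<partial>lborel)
         \<le> ennreal ((768 * norm e * (norm e / sqrt h)) * ((16 * pi) powr (DIM('a) / 2) * h powr (s - 3/2)))"
      proof (rule nn_integral_dilated_gaussian_le[OF h])
        fix y
        define \<zeta> where "\<zeta> = (x - y) /\<^sub>R sqrt h"
        define \<eta> where "\<eta> = e /\<^sub>R sqrt h"
        have e: "e = sqrt h *\<^sub>R \<eta>" using h by (simp add: \<eta>_def)
        have n: "norm \<eta> = norm e / sqrt h" unfolding \<eta>_def by (rule norm_div_sqrt[OF h])
        have sh: "(x' - y) /\<^sub>R sqrt h = \<zeta> + \<eta>"
          by (simp add: \<zeta>_def \<eta>_def e_def flip: scaleR_add_right)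
        let ?H = "h powr (s - 3/2 - DIM('a) / 2)"
        have "heat_kernel s (x' - y) h - heat_kernel s (x - y) h - e \<bullet> grad_kernel s (x - y) h
           = (?H * sqrt h) * (gauss_profile (\<zeta> + \<eta>) - gauss_profile \<zeta> - \<eta> \<bullet> grad_profile \<zeta>)"
          unfolding self_similar_def \<zeta>_def[symmetric] sh split using h
          by (subst e) (simp add: right_diff_distrib)
        then have "norm (heat_kernel s (x' - y) h - heat_kernel s (x - y) h - e \<bullet> grad_kernel s (x - y) h)
           = (?H * sqrt h) * norm (gauss_profile (\<zeta> + \<eta>) - gauss_profile \<zeta> - \<eta> \<bullet> grad_profile \<zeta>)"
          using h by (simp add: abs_mult)
        also have "\<dots> \<le> (?H * sqrt h) * (768 * (norm \<eta>)\<^sup>2 * exp (- ((norm \<zeta>)\<^sup>2 / 16)))"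
          using le1 n h by (intro mult_left_mono gauss_profile_taylor_le) auto
        also have "\<dots> = 768 * (sqrt h * norm \<eta>) * norm \<eta> * (?H * exp (- ((norm \<zeta>)\<^sup>2 / 16)))"
          by (simp add: power2_eq_square mult_ac)
        also have "sqrt h * norm \<eta> = norm e"
          using h n by simp
        finally show "norm (heat_kernel s (x' - y) h - heat_kernel s (x - y) h - e \<bullet> grad_kernel s (x - y) h)
          \<le> 768 * norm e * (norm e / sqrt h) * (?H * exp (- ((norm ((x - y) /\<^sub>R sqrt h))\<^sup>2 / 16)))"
          unfolding \<zeta>_def[symmetric] n .
      qed (use h in auto)
      also have "\<dots> = ennreal (768 * G * (norm e * (h powr (s - 3/2) * m)))"
        unfolding m min_absorb2[OF le1] G_def by (simp only: mult_ac)
      also have "\<dots> \<le> ennreal (D * (norm e * (h powr (s - 3/2) * m)))"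
        using D h m by (intro ennreal_leI mult_right_mono) auto
      finally show ?thesis by (simp only: mult.assoc)
    next
      case False
      have sq: "sqrt h \<le> norm e"
        using False h by (simp add: real_le_lsqrt)
      then have m1: "m = 1" using h by (simp add: m)
      have "(\<integral>\<^sup>+y. ennreal (norm (heat_kernel s (x' - y) h - heat_kernel s (x - y) h - e \<bullet> grad_kernel s (x - y) h)) \<partial>lborel)
        \<le> (\<integral>\<^sup>+y. ennreal (norm (heat_kernel s (x' - y) h - heat_kernel s (x - y) h)) + ennreal (norm e) * ennreal (norm (grad_kernel s (x - y) h)) \<partial>lborel)"
      proof (rule nn_integral_mono)
        fix y
        have "norm (heat_kernel s (x' - y) h - heat_kernel s (x - y) h - e \<bullet> grad_kernel s (x - y) h)
          \<le> norm (heat_kernel s (x' - y) h - heat_kernel s (x - y) h) + norm e * norm (grad_kernel s (x - y) h)"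
          by (rule order.trans[OF norm_triangle_ineq4 add_left_mono]) (simp add: Cauchy_Schwarz_ineq2)
        then show "ennreal (norm (heat_kernel s (x' - y) h - heat_kernel s (x - y) h - e \<bullet> grad_kernel s (x - y) h))
          \<le> ennreal (norm (heat_kernel s (x' - y) h - heat_kernel s (x - y) h)) + ennreal (norm e) * ennreal (norm (grad_kernel s (x - y) h))"
          by (simp add: ennreal_leI ennreal_mult'[symmetric] ennreal_plus[symmetric] del: ennreal_plus)
      qed
      also have "\<dots> = (\<integral>\<^sup>+y. ennreal (norm (heat_kernel s (x' - y) h - heat_kernel s (x - y) h)) \<partial>lborel)
           + ennreal (norm e) * (\<integral>\<^sup>+y. ennreal (norm (grad_kernel s (x - y) h)) \<partial>lborel)"
        by (subst nn_integral_add, measurable, subst nn_integral_cmult, measurable)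
      also have "\<dots> \<le> ennreal (2 * U.A * h powr (s - 1)) + ennreal (norm e) * ennreal (V.A * (h powr (s - 3/2) * indicator {0<..} h))"
        using h by (intro add_mono mult_left_mono U.slice_diff_triangle_le V.slice_le) auto
      also have "\<dots> = ennreal (2 * U.A * h powr (s - 1) + norm e * (V.A * h powr (s - 3/2)))"
        using h U.A_nonneg V.A_nonneg by (simp add: ennreal_mult'[symmetric])
      also have "\<dots> \<le> ennreal (D * norm e * (h powr (s - 3/2) * m))"
      proof (rule ennreal_leI)
        have "2 * U.A * h powr (s - 1) + norm e * (V.A * h powr (s - 3/2)) = 2 * U.A * h powr (s - 3/2) * sqrt h + V.A * h powr (s - 3/2) * norm e"
          using split[of 0] by (simp add: mult_ac)
        also have "\<dots> \<le> 2 * U.A * h powr (s - 3/2) * norm e + V.A * h powr (s - 3/2) * norm e"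
          using sq U.A_nonneg by (intro add_right_mono mult_left_mono) auto
        also have "\<dots> = (2 * U.A + V.A) * (norm e * h powr (s - 3/2))"
          by (simp add: algebra_simps)
        also have "\<dots> \<le> D * (norm e * h powr (s - 3/2))"
          using D by (intro mult_right_mono) auto
        finally show "2 * U.A * h powr (s - 1) + norm e * (V.A * h powr (s - 3/2)) \<le> D * norm e * (h powr (s - 3/2) * m)"
          unfolding m1 by (simp only: mult.assoc mult_1_right)
      qed
      finally show ?thesis .
    qed
    show ?thesis
      using bound[OF refl] h unfolding e_def powr_half_ratio[OF h] by simp
  next
    case False
    then show ?thesis by (simp add: self_similar_def)
  qed
  then show ?thesis using D(1) by blast
qed

text \<open>Integrating the slice remainder in time gives the order \<open>2 * s\<close> in the
  distance, which is superlinear because \<open>s > 1/2\<close>. \<open>D\<close> is fixed before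
  the source and the points.\<close>

lemma potential_taylor_le:
  assumes s: "1/2 < s" "s < 1"
  shows "\<exists>D\<ge>0. \<forall>(g :: 'a::euclidean_space \<times> real \<Rightarrow> real) M x x' t. bounded_source g M \<longrightarrow>
     \<bar>potential (heat_kernel s) g x' t - potential (heat_kernel s) g x t - (x' - x) \<bullet> potential (grad_kernel s) g x t\<bar>
      \<le> M * D * norm (x' - x) * norm (x' - x) powr (2 * s - 1)"
proof -
  interpret U: self_similar_kernel "gauss_profile :: 'a \<Rightarrow> real" "s - 1" "1024 * (DIM('a) / 2 + 2 - s)"
    using s by (intro self_similar_kernel_gauss_profile) auto
  interpret V: self_similar_kernel "grad_profile :: 'a \<Rightarrow> 'a" "s - 3/2" "1024 * (DIM('a) / 2 + 7/2 - s)"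
    using s by (intro self_similar_kernel_grad_profile) auto
  obtain D where D: "0 \<le> D" and slice: "\<And>(x::'a) x' h.
    (\<integral>\<^sup>+y. ennreal (norm (heat_kernel s (x' - y) h - heat_kernel s (x - y) h - (x' - x) \<bullet> grad_kernel s (x - y) h)) \<partial>lborel)
     \<le> ennreal (D * norm (x' - x) * (h powr (s - 3/2) * min 1 (((norm (x' - x))\<^sup>2 / h) powr (1/2)) * indicator {0<..} h))"
    using slice_taylor_le[OF s, where 'a='a] by blast
  define L where "L = 1 / (s - 3/2 + 1) + 1 / (1/2 - (s - 3/2) - 1)"
  have L: "0 \<le> L"
  proof -
    have "L = 1 / (s - 1/2) + 1 / (1 - s)" by (simp add: L_def)
    then show ?thesis using s by simp
  qed
  have "\<bar>potential (heat_kernel s) g x' t - potential (heat_kernel s) g x t - (x' - x) \<bullet> potential (grad_kernel s) g x t\<bar>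
      \<le> M * (D * L) * norm (x' - x) * norm (x' - x) powr (2 * s - 1)"
    if g: "bounded_source g M" for g :: "'a \<times> real \<Rightarrow> real" and M x x' t
  proof (cases "x' = x")
    case False
    define r where "r = norm (x' - x)"
    have r: "0 < r" using False by (simp add: r_def)
    let ?q = "\<lambda>p. heat_kernel s (x' - fst p) (t - snd p) - heat_kernel s (x - fst p) (t - snd p) - (x' - x) \<bullet> grad_kernel s (x - fst p) (t - snd p)"
    let ?f = "\<lambda>h. h powr (s - 3/2) * min 1 ((r\<^sup>2 / h) powr (1/2)) * indicator {0<..} h"
    define I where "I = D * r * (L * (r\<^sup>2) powr (s - 3/2 + 1))"
    have "potential (heat_kernel s) g x' t - potential (heat_kernel s) g x t - (x' - x) \<bullet> potential (grad_kernel s) g x t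
      = (\<integral>p. g p *\<^sub>R (heat_kernel s (x' - fst p) (t - snd p) - heat_kernel s (x - fst p) (t - snd p)) \<partial>lborel)
        - (\<integral>p. (x' - x) \<bullet> (g p *\<^sub>R grad_kernel s (x - fst p) (t - snd p)) \<partial>lborel)"
      unfolding U.potential_diff_eq[OF g]
      unfolding potential_def[of "grad_kernel s"]
      by (subst integral_inner_right) (simp_all only: V.integrable_potential[OF g])
    also have "\<dots> = (\<integral>p. g p *\<^sub>R (heat_kernel s (x' - fst p) (t - snd p) - heat_kernel s (x - fst p) (t - snd p))
         - (x' - x) \<bullet> (g p *\<^sub>R grad_kernel s (x - fst p) (t - snd p)) \<partial>lborel)"
      using Bochner_Integration.integrable_diff[OF U.integrable_potential[OF g, of x' t] U.integrable_potential[OF g, of x t]]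
        integrable_inner_right[OF V.integrable_potential[OF g, of x t], of "x' - x"]
      by (intro Bochner_Integration.integral_diff[symmetric]) (simp_all only: scaleR_diff_right)
    also have "\<dots> = (\<integral>p. g p *\<^sub>R ?q p \<partial>lborel)"
      by (simp only: inner_scaleR_right real_scaleR_def right_diff_distrib)
    finally have eq: "potential (heat_kernel s) g x' t - potential (heat_kernel s) g x t - (x' - x) \<bullet> potential (grad_kernel s) g x t
       = (\<integral>p. g p *\<^sub>R ?q p \<partial>lborel)" .
    have "norm (\<integral>p. g p *\<^sub>R ?q p \<partial>lborel) \<le> M * I"
    proof (rule integral_source_le(2)[OF g])
      show "(\<integral>\<^sup>+y. ennreal (norm (?q (y, \<tau>))) \<partial>lborel) \<le> ennreal (D * r * ?f (t - \<tau>))" for \<tau>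
        using slice[of x' "t - \<tau>" x] by (simp only: r_def fst_conv snd_conv)
      have "(\<integral>\<^sup>+\<tau>. ennreal (D * r * ?f (t - \<tau>)) * indicator {-4<..<4} \<tau> \<partial>lborel)
         \<le> (\<integral>\<^sup>+\<tau>. ennreal (D * r * ?f (t - \<tau>)) \<partial>lborel)"
        by (rule nn_integral_mono) (auto simp: indicator_def)
      also have "\<dots> \<le> ennreal I"
        unfolding I_def
      proof (rule nn_integral_scaled_le[where f = ?f])
        show "(\<integral>\<^sup>+h. ennreal (?f h) \<partial>lborel) \<le> ennreal (L * (r\<^sup>2) powr (s - 3/2 + 1))"
          unfolding L_def using s r by (intro nn_integral_powr_min_le) auto
      qed (use D r in auto)
      finally show "(\<integral>\<^sup>+\<tau>. ennreal (D * r * ?f (t - \<tau>)) * indicator {-4<..<4} \<tau> \<partial>lborel) \<le> ennreal I" .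
      show "0 \<le> I" using D L r by (simp add: I_def)
    qed measurable
    moreover have "(r\<^sup>2) powr (s - 3/2 + 1) = r powr (2 * s - 1)"
    proof -
      have "r\<^sup>2 = r powr 2" using r by simp
      moreover have "2 * (s - 3/2 + 1) = 2 * s - 1" by simp
      ultimately show ?thesis by (simp only: powr_powr)
    qed
    then have "M * I = M * (D * L) * r * r powr (2 * s - 1)"
      by (simp only: I_def mult_ac)
    ultimately show ?thesis unfolding eq r_def by simp
  qed simp
  then show ?thesis using D L by (intro exI[of _ "D * L"]) auto
qed

text \<open>Divided by the distance, the Taylor remainder is of order \<open>2 * s - 1 > 0\<close>
  and tends to 0; this takes the place of differentiating under the integral sign.\<close>

lemma GDERIV_potential:
  fixes g :: "'a::euclidean_space \<times> real \<Rightarrow> real"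
  assumes s: "1/2 < s" "s < 1" and g: "bounded_source g M"
  shows "GDERIV (\<lambda>y. potential (heat_kernel s) g y t) x :> potential (grad_kernel s) g x t"
proof -
  obtain D where D: "0 \<le> D" and taylor: "\<And>(g :: 'a \<times> real \<Rightarrow> real) M x x' t. bounded_source g M \<Longrightarrow>
     \<bar>potential (heat_kernel s) g x' t - potential (heat_kernel s) g x t - (x' - x) \<bullet> potential (grad_kernel s) g x t\<bar>
      \<le> M * D * norm (x' - x) * norm (x' - x) powr (2 * s - 1)"
    using potential_taylor_le[OF s, where 'a='a] by blast
  show ?thesis unfolding gderiv_def
  proof (rule has_derivativeI_sandwich[of 1])
    show "bounded_linear (\<lambda>h. h \<bullet> potential (grad_kernel s) g x t)"
      by (rule bounded_linear_inner_left)
    show "norm (potential (heat_kernel s) g y t - potential (heat_kernel s) g x t - (y - x) \<bullet> potential (grad_kernel s) g x t) / norm (y - x)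
       \<le> M * D * norm (y - x) powr (2 * s - 1)" if "y \<noteq> x" for y
      using taylor[OF g, of y t x] that by (simp add: divide_le_eq mult_ac)
    have "((\<lambda>y. M * D * norm (y - x) powr (2 * s - 1)) \<longlongrightarrow> M * D * norm (x - x) powr (2 * s - 1)) (at x)"
      using s by (intro tendsto_intros tendsto_powr') auto
    then show "((\<lambda>y. M * D * norm (y - x) powr (2 * s - 1)) \<longlongrightarrow> 0) (at x)"
      by simp
  qed simp
qed

section \<open>Norms of potentials\<close>

lemma sup_norm_le: "(\<And>p. p \<in> \<Omega> \<Longrightarrow> norm (u p) \<le> K) \<Longrightarrow> sup_norm \<Omega> u \<le> ennreal K"
  unfolding sup_norm_def by (intro SUP_least ennreal_leI)

lemma holder_seminorm_le:
  "0 \<le> K \<Longrightarrow> (\<And>x y. x \<in> D \<Longrightarrow> y \<in> D \<Longrightarrow> norm (g x - g y) \<le> K * dist x y powr \<alpha>) \<Longrightarrow> holder_seminorm \<alpha> D g \<le> ennreal K"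
  unfolding holder_seminorm_def by (rule INF_lower) auto

lemma holder_seminorm_space_le:
  "0 \<le> K \<Longrightarrow> (\<And>x y t. norm (u (x, t) - u (y, t)) \<le> K * dist x y powr \<alpha>) \<Longrightarrow> holder_seminorm_space \<alpha> \<Omega> u \<le> ennreal K"
  unfolding holder_seminorm_space_def by (intro SUP_least holder_seminorm_le)

lemma holder_seminorm_time_le:
  "0 \<le> K \<Longrightarrow> (\<And>x t t'. norm (u (x, t) - u (x, t')) \<le> K * dist t t' powr \<alpha>) \<Longrightarrow> holder_seminorm_time \<alpha> \<Omega> u \<le> ennreal K"
  unfolding holder_seminorm_time_def by (intro SUP_least holder_seminorm_le)

lemma log_lipschitz_seminorm_space_le:
  assumes "\<And>x y t. (x, t) \<in> \<Omega> \<Longrightarrow> (y, t) \<in> \<Omega> \<Longrightarrow> x \<noteq> y \<Longrightarrow>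
     \<bar>u (x, t) - u (y, t)\<bar> \<le> K * (norm (x - y) * \<bar>ln (min (norm (x - y)) (1/2))\<bar>)"
  shows "log_lipschitz_seminorm_space \<Omega> u \<le> ennreal K"
  unfolding log_lipschitz_seminorm_space_def log_lipschitz_seminorm_def
proof (intro SUP_least, clarify, rule ennreal_leI)
  fix t x y assume *: "(x, t) \<in> \<Omega>" "(y, t) \<in> \<Omega>" "x \<noteq> y"
  have "0 < norm (x - y) * \<bar>ln (min (norm (x - y)) (1/2))\<bar>"
    using ln_min_half_bounds(1)[of "norm (x - y)"] *(3) by (intro mult_pos_pos) auto
  then show "\<bar>u (x, t) - u (y, t)\<bar> / (norm (x - y) * \<bar>ln (min (norm (x - y)) (1/2))\<bar>) \<le> K"
    using assms[OF *] by (simp add: divide_le_eq)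
qed

text \<open>Pass through the intermediate point \<open>(y, t)\<close>. Both
  \<open>norm (x - y)\<close> and the square root of the time difference are below the parabolic
  distance, and the power \<open>\<beta>\<close> of the time difference is the power
  \<open>2 * \<beta>\<close> of that root.\<close>

lemma par_holder_seminorm_le:
  assumes K: "0 \<le> K1" "0 \<le> K2" and b: "0 < \<beta>"
    and space: "\<And>x y t. \<bar>u (x, t) - u (y, t)\<bar> \<le> K1 * norm (x - y) powr (2 * \<beta>)"
    and time: "\<And>x t t'. \<bar>u (x, t) - u (x, t')\<bar> \<le> K2 * \<bar>t - t'\<bar> powr \<beta>"
  shows "par_holder_seminorm \<beta> \<Omega> u \<le> ennreal (K1 + K2)"
proof -
  have "\<bar>u (x, t) - u (y, \<tau>)\<bar> \<le> (K1 + K2) * (norm (x - y) + sqrt \<bar>t - \<tau>\<bar>) powr (2 * \<beta>)" for x t y \<tau>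
  proof -
    let ?r = "norm (x - y) + sqrt \<bar>t - \<tau>\<bar>"
    have "\<bar>t - \<tau>\<bar> powr \<beta> = sqrt \<bar>t - \<tau>\<bar> powr (2 * \<beta>)"
      by (simp add: powr_half_sqrt[symmetric] powr_powr)
    moreover have "sqrt \<bar>t - \<tau>\<bar> powr (2 * \<beta>) \<le> ?r powr (2 * \<beta>)" "norm (x - y) powr (2 * \<beta>) \<le> ?r powr (2 * \<beta>)"
      using b by (intro powr_mono2; simp)+
    ultimately have 3: "K1 * norm (x - y) powr (2 * \<beta>) \<le> K1 * ?r powr (2 * \<beta>)" "K2 * \<bar>t - \<tau>\<bar> powr \<beta> \<le> K2 * ?r powr (2 * \<beta>)"
      using K by (auto intro: mult_left_mono)
    have "\<bar>u (x, t) - u (y, \<tau>)\<bar> \<le> \<bar>u (x, t) - u (y, t)\<bar> + \<bar>u (y, t) - u (y, \<tau>)\<bar>" by linarith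
    also have "\<dots> \<le> K1 * ?r powr (2 * \<beta>) + K2 * ?r powr (2 * \<beta>)"
      using space[of x t y] time[of y t \<tau>] 3 by linarith
    finally show ?thesis by (simp add: distrib_right)
  qed
  then show ?thesis
    unfolding par_holder_seminorm_def using K by (intro INF_lower) auto
qed

text \<open>Uniqueness allows the definite description in \<open>grad_x\<close> to be
  evaluated.\<close>

lemma GDERIV_unique:
  assumes "GDERIV f x :> D" "GDERIV f x :> D'"
  shows "D = D'"
proof -
  have "(\<lambda>h. h \<bullet> D) = (\<lambda>h. h \<bullet> D')"
    using assms unfolding gderiv_def by (rule has_derivative_unique)
  then show ?thesis by (metis vector_eq_ldot)
qed

lemma grad_x_eqI:
  assumes "\<And>x t. GDERIV (\<lambda>y. u (y, t)) x :> v (x, t)"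
  shows "grad_x u = v"
  unfolding grad_x_def using assms by (auto simp: fun_eq_iff intro!: the_equality dest: GDERIV_unique)

section \<open>Norm bounds in the three ranges of \<open>s\<close>\<close>

lemma (in self_similar_kernel) potential_sup_le:
  assumes g: "bounded_source g M" and t: "t < 1"
  shows "norm (potential ker g x t) \<le> M * (A * (5 powr (a + 1) / (a + 1)))"
proof -
  have "max 0 (t + 4) powr (a + 1) \<le> 5 powr (a + 1)"
    using a t by (intro powr_mono2) auto
  then have "M * (A * (max 0 (t + 4) powr (a + 1) / (a + 1))) \<le> M * (A * (5 powr (a + 1) / (a + 1)))"
    using a A_nonneg bounded_source_nonneg[OF g] by (intro mult_left_mono divide_right_mono) auto
  with potential_le[OF g] show ?thesis by (rule order.trans)
qed

text \<open>\<open>s < 1/2\<close> is the tail condition \<open>s - 1 < -1/2\<close>, so the kernel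
  itself yields the spatial exponent \<open>2 * s\<close>. Requiring only pointwise agreement of
  \<open>w\<close> with the potential makes the bound applicable to functions on pairs.\<close>

lemma par_holder_norm_potential_le_low:
  assumes s: "0 < s" "s < 1/2"
  shows "\<exists>C\<ge>0. \<forall>(g :: 'a::euclidean_space \<times> real \<Rightarrow> real) M w \<Omega>. bounded_source g M \<longrightarrow>
     (\<forall>x t. w (x, t) = potential (heat_kernel s) g x t) \<longrightarrow> (\<forall>p\<in>\<Omega>. snd p < 1) \<longrightarrow>
     par_holder_norm s \<Omega> w \<le> ennreal (M * C)"
proof -
  interpret U: self_similar_kernel "gauss_profile :: 'a \<Rightarrow> real" "s - 1" "1024 * (DIM('a) / 2 + 2 - s)"
    using s by (intro self_similar_kernel_gauss_profile) auto
  define C0 where "C0 = U.A * (5 powr s / s)"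
  define C1 where "C1 = 2 * U.A * (1 / s + 1 / (1/2 - s))"
  define C2 where "C2 = U.A * (3 / s + 2 / (1 - s))"
  have C: "0 \<le> C0" "0 \<le> C1" "0 \<le> C2"
    using s U.A_nonneg by (auto simp: C0_def C1_def C2_def)
  have "par_holder_norm s \<Omega> w \<le> ennreal (M * (C0 + C1 + C2))"
    if g: "bounded_source g M" and w: "\<forall>x t. w (x, t) = potential (heat_kernel s) g x t" and \<Omega>: "\<forall>p\<in>\<Omega>. snd p < 1"
    for g :: "'a \<times> real \<Rightarrow> real" and M w \<Omega>
  proof -
    have M: "0 \<le> M" using g by (rule bounded_source_nonneg)
    have "sup_norm \<Omega> w \<le> ennreal (M * C0)"
    proof (rule sup_norm_le)
      fix p assume "p \<in> \<Omega>"
      then show "norm (w p) \<le> M * C0"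
        using U.potential_sup_le[OF g, of "snd p" "fst p"] \<Omega> w[rule_format, of "fst p" "snd p"] by (simp add: C0_def)
    qed
    moreover have "par_holder_seminorm s \<Omega> w \<le> ennreal (M * C1 + M * C2)"
    proof (rule par_holder_seminorm_le)
      show "\<bar>w (x, t) - w (y, t)\<bar> \<le> M * C1 * norm (x - y) powr (2 * s)" for x y t
        using U.potential_space_holder[OF g, of x t y] s by (simp add: w C1_def)
      show "\<bar>w (x, t) - w (x, t')\<bar> \<le> M * C2 * \<bar>t - t'\<bar> powr s" for x t t'
        using U.potential_time_holder[OF g, of x t t'] by (simp add: w C2_def)
    qed (use M C s in auto)
    ultimately have "sup_norm \<Omega> w + par_holder_seminorm s \<Omega> w \<le> ennreal (M * C0) + ennreal (M * C1 + M * C2)"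
      by (rule add_mono)
    also have "\<dots> = ennreal (M * (C0 + C1 + C2))"
      using M C by (subst ennreal_plus[symmetric]) (auto simp: distrib_left)
    finally show ?thesis using s by (simp add: par_holder_norm_def)
  qed
  then show ?thesis using C by (intro exI[of _ "C0 + C1 + C2"]) auto
qed

text \<open>With \<open>a = s - 3/2\<close> for the gradient, \<open>2 * (a + 1) = 2 * s - 1\<close>
  and \<open>a + 1 = s - 1/2\<close> are the exponents that the norm demands, and the tail condition
  \<open>a < -1/2\<close> is \<open>s < 1\<close>. Time regularity of \<open>w\<close> itself comes
  from the kernel.\<close>

lemma par_holder_norm_potential_le_high:
  assumes s: "1/2 < s" "s < 1"
  shows "\<exists>C\<ge>0. \<forall>(g :: 'a::euclidean_space \<times> real \<Rightarrow> real) M w \<Omega>. bounded_source g M \<longrightarrow>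
     (\<forall>x t. w (x, t) = potential (heat_kernel s) g x t) \<longrightarrow> (\<forall>p\<in>\<Omega>. snd p < 1) \<longrightarrow>
     par_holder_norm s \<Omega> w \<le> ennreal (M * C)"
proof -
  interpret U: self_similar_kernel "gauss_profile :: 'a \<Rightarrow> real" "s - 1" "1024 * (DIM('a) / 2 + 2 - s)"
    using s by (intro self_similar_kernel_gauss_profile) auto
  interpret V: self_similar_kernel "grad_profile :: 'a \<Rightarrow> 'a" "s - 3/2" "1024 * (DIM('a) / 2 + 7/2 - s)"
    using s by (intro self_similar_kernel_grad_profile) auto
  define C0 where "C0 = U.A * (5 powr s / s)"
  define C1 where "C1 = V.A * (5 powr (s - 1/2) / (s - 1/2))"
  define C2 where "C2 = U.A * (3 / s + 2 / (1 - s))"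
  define C3 where "C3 = 2 * V.A * (1 / (s - 1/2) + 1 / (1 - s))"
  define C4 where "C4 = V.A * (3 / (s - 1/2) + 2 / (3/2 - s))"
  have C: "0 \<le> C0" "0 \<le> C1" "0 \<le> C2" "0 \<le> C3" "0 \<le> C4"
    using s U.A_nonneg V.A_nonneg by (auto simp: C0_def C1_def C2_def C3_def C4_def)
  have ex: "s - 3/2 + 1 = s - 1/2" "1/2 - (s - 3/2) - 1 = 1 - s" "- (s - 3/2) = 3/2 - s" "2 * (s - 1/2) = 2 * s - 1"
    by simp_all
  have "par_holder_norm s \<Omega> w \<le> ennreal (M * (C0 + C1 + C2 + C3 + C4))"
    if g: "bounded_source g M" and w: "\<forall>x t. w (x, t) = potential (heat_kernel s) g x t" and \<Omega>: "\<forall>p\<in>\<Omega>. snd p < 1"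
    for g :: "'a \<times> real \<Rightarrow> real" and M w \<Omega>
  proof -
    have M: "0 \<le> M" using g by (rule bounded_source_nonneg)
    have D: "GDERIV (\<lambda>y. w (y, t)) x :> potential (grad_kernel s) g x t" for x t
      using GDERIV_potential[OF s g] by (simp add: w)
    have grad: "grad_x w = (\<lambda>(x, t). potential (grad_kernel s) g x t)"
      by (rule grad_x_eqI) (simp add: D)
    have "sup_norm \<Omega> w \<le> ennreal (M * C0)"
    proof (rule sup_norm_le)
      fix p assume "p \<in> \<Omega>"
      then show "norm (w p) \<le> M * C0"
        using U.potential_sup_le[OF g, of "snd p" "fst p"] \<Omega> w[rule_format, of "fst p" "snd p"] by (simp add: C0_def)
    qed
    moreover have "sup_norm \<Omega> (grad_x w) \<le> ennreal (M * C1)"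
    proof (rule sup_norm_le)
      fix p assume "p \<in> \<Omega>"
      then show "norm (grad_x w p) \<le> M * C1"
        using V.potential_sup_le[OF g, of "snd p" "fst p"] \<Omega> unfolding grad C1_def ex by (simp add: case_prod_beta)
    qed
    moreover have "holder_seminorm_time s \<Omega> w \<le> ennreal (M * C2)"
    proof (rule holder_seminorm_time_le)
      show "norm (w (x, t) - w (x, t')) \<le> M * C2 * dist t t' powr s" for x t t'
        using U.potential_time_holder[OF g, of x t t'] by (simp add: w C2_def dist_real_def)
    qed (use M C in auto)
    moreover have "holder_seminorm_space (2 * s - 1) \<Omega> (grad_x w) \<le> ennreal (M * C3)"
    proof (rule holder_seminorm_space_le)
      show "norm (grad_x w (x, t) - grad_x w (y, t)) \<le> M * C3 * dist x y powr (2 * s - 1)" for x y t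
        using V.potential_space_holder[OF g, of x t y] s unfolding grad C3_def ex by (simp add: dist_norm)
    qed (use M C in auto)
    moreover have "holder_seminorm_time (s - 1/2) \<Omega> (grad_x w) \<le> ennreal (M * C4)"
    proof (rule holder_seminorm_time_le)
      show "norm (grad_x w (x, t) - grad_x w (x, t')) \<le> M * C4 * dist t t' powr (s - 1/2)" for x t t'
        using V.potential_time_holder[OF g, of x t t'] unfolding grad C4_def ex by (simp add: dist_real_def)
    qed (use M C in auto)
    ultimately have "sup_norm \<Omega> w + sup_norm \<Omega> (grad_x w) + holder_seminorm_time s \<Omega> w
        + holder_seminorm_space (2 * s - 1) \<Omega> (grad_x w) + holder_seminorm_time (s - 1/2) \<Omega> (grad_x w)
      \<le> ennreal (M * C0) + ennreal (M * C1) + ennreal (M * C2) + ennreal (M * C3) + ennreal (M * C4)"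
      by (intro add_mono)
    also have "\<dots> = ennreal (M * (C0 + C1 + C2 + C3 + C4))"
      using M C by (simp add: distrib_left)
    finally show ?thesis using s D by (auto simp: par_holder_norm_def)
  qed
  then show ?thesis using C by (intro exI[of _ "C0 + C1 + C2 + C3 + C4"]) auto
qed

text \<open>The conditions on \<open>\<Omega>\<close> supply what the logarithmic integral needs:
  points at distance below 2 and elapsed times below 5.\<close>

lemma log_lipschitz_holder_norm_potential_le:
  shows "\<exists>C\<ge>0. \<forall>(g :: 'a::euclidean_space \<times> real \<Rightarrow> real) M w \<Omega>. bounded_source g M \<longrightarrow>
     (\<forall>x t. w (x, t) = potential (heat_kernel (1/2)) g x t) \<longrightarrow>
     (\<forall>p\<in>\<Omega>. norm (fst p) < 1 \<and> snd p < 1) \<longrightarrow>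
     log_lipschitz_holder_norm (1/2) \<Omega> w \<le> ennreal (M * C)"
proof -
  interpret U: self_similar_kernel "gauss_profile :: 'a \<Rightarrow> real" "1/2 - 1" "1024 * (DIM('a) / 2 + 2 - 1/2)"
    by (intro self_similar_kernel_gauss_profile) auto
  have ex: "1/2 - 1 + 1 = (1/2 :: real)" "- (1/2 - 1) = (1/2 :: real)" by simp_all
  define C0 where "C0 = U.A * (5 powr (1/2) / (1/2))"
  define C1 where "C1 = 28 * U.A"
  define C2 where "C2 = U.A * (3 / (1/2) + 2 / (1/2))"
  have C: "0 \<le> C0" "0 \<le> C1" "0 \<le> C2"
    using U.A_nonneg by (auto simp: C0_def C1_def C2_def)
  have "log_lipschitz_holder_norm (1/2) \<Omega> w \<le> ennreal (M * (C0 + C1 + C2))"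
    if g: "bounded_source g M" and w: "\<forall>x t. w (x, t) = potential (heat_kernel (1/2)) g x t"
      and \<Omega>: "\<forall>p\<in>\<Omega>. norm (fst p) < 1 \<and> snd p < 1"
    for g :: "'a \<times> real \<Rightarrow> real" and M w \<Omega>
  proof -
    have M: "0 \<le> M" using g by (rule bounded_source_nonneg)
    have "sup_norm \<Omega> w \<le> ennreal (M * C0)"
    proof (rule sup_norm_le)
      fix p assume "p \<in> \<Omega>"
      then show "norm (w p) \<le> M * C0"
        using U.potential_sup_le[OF g, of "snd p" "fst p"] \<Omega> w[rule_format, of "fst p" "snd p"]
        unfolding C0_def ex by simp
    qed
    moreover have "log_lipschitz_seminorm_space \<Omega> w \<le> ennreal (M * C1)"
    proof (rule log_lipschitz_seminorm_space_le)
      fix x y t assume *: "(x, t) \<in> \<Omega>" "(y, t) \<in> \<Omega>" "x \<noteq> y"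
      then have "norm x < 1" "norm y < 1" "t < 1" using \<Omega> by force+
      then have "norm (x - y) < 2" using norm_triangle_ineq4[of x y] by linarith
      then show "\<bar>w (x, t) - w (y, t)\<bar> \<le> M * C1 * (norm (x - y) * \<bar>ln (min (norm (x - y)) (1/2))\<bar>)"
        using U.potential_space_log_lipschitz[OF g _ _ _ \<open>t < 1\<close>, of y x] *(3) unfolding C1_def w[rule_format] by simp
    qed
    moreover have "holder_seminorm_time (1/2) \<Omega> w \<le> ennreal (M * C2)"
    proof (rule holder_seminorm_time_le)
      show "norm (w (x, t) - w (x, t')) \<le> M * C2 * dist t t' powr (1/2)" for x t t'
        using U.potential_time_holder[OF g, of x t t'] unfolding C2_def ex w[rule_format] dist_real_def .
    qed (use M C in auto)
    ultimately have "log_lipschitz_holder_norm (1/2) \<Omega> w \<le> ennreal (M * C0) + ennreal (M * C1) + ennreal (M * C2)"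
      unfolding log_lipschitz_holder_norm_def by (intro add_mono)
    also have "\<dots> = ennreal (M * (C0 + C1 + C2))"
      using M C by (simp add: distrib_left)
    finally show ?thesis .
  qed
  then show ?thesis using C by (intro exI[of _ "C0 + C1 + C2"]) auto
qed

section \<open>From iterated Lebesgue integrals to one Borel integral\<close>

lemma integral_completion_cong_AE:
  fixes f f' :: "'a \<Rightarrow> real"
  assumes f' [measurable]: "f' \<in> borel_measurable M" and ae: "AE x in M. f x = f' x"
  shows "(\<integral>x. f x \<partial>completion M) = (\<integral>x. f' x \<partial>M)"
proof -
  have ae': "AE x in completion M. f x = f' x" using ae by (rule AE_completion)
  have f'': "f' \<in> borel_measurable (completion M)" by (rule measurable_completion) measurable
  \<comment> \<open>Measurability of \<open>f\<close> is derived: its preimages differ from those of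
    \<open>f'\<close> by null sets only, and the completion contains every such set.\<close>
  have f: "f \<in> borel_measurable (completion M)"
  proof (rule measurableI)
    fix S :: "real set" assume "S \<in> sets borel"
    then have "f' -` S \<inter> space (completion M) \<in> sets (completion M)"
      using f'' by (rule measurable_sets[rotated])
    then show "f -` S \<inter> space (completion M) \<in> sets (completion M)"
      by (rule completion.in_sets_AE[rotated]) (use ae' in auto)
  qed simp
  have "(\<integral>x. f x \<partial>completion M) = (\<integral>x. f' x \<partial>completion M)"
    by (rule integral_cong_AE[OF f f'' ae'])
  also have "\<dots> = (\<integral>x. f' x \<partial>M)" by (rule integral_completion) measurable
  finally show ?thesis .
qed

text \<open>The exceptional set need not be measurable, so it is covered by a measurable null set
  \<open>N\<close>. The product argument fixes the space variable first; exchanging the order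
  afterwards uses the measurability of \<open>N\<close>.\<close>

lemma AE_lborel_slices:
  fixes P :: "'a::euclidean_space \<times> 'b::euclidean_space \<Rightarrow> bool"
  assumes "AE p in lborel. P p"
  shows "AE \<tau> in lborel. AE y in lborel. P (y, \<tau>)"
proof -
  obtain N where "{p \<in> space lborel. \<not> P p} \<subseteq> N" "emeasure lborel N = 0" "N \<in> sets lborel"
    using assms by (rule AE_E)
  then have N: "{p \<in> space lborel. \<not> P p} \<subseteq> N" "N \<in> null_sets lborel" by auto
  have sets [measurable]: "N \<in> sets (lborel \<Otimes>\<^sub>M lborel)"
    using N(2) unfolding lborel_prod by (rule null_setsD2)
  have "AE p in lborel \<Otimes>\<^sub>M lborel. p \<notin> N"
    using N(2) unfolding lborel_prod by (rule AE_not_in)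
  then have "AE y in lborel. AE \<tau> in lborel. (y, \<tau>) \<notin> N"
    by (rule lborel_pair.AE_pair)
  then have "AE \<tau> in lborel. AE y in lborel. (y, \<tau>) \<notin> N"
    by (subst (asm) lborel_pair.AE_commute) measurable
  then show ?thesis
  proof eventually_elim
    case (elim \<tau>)
    then show ?case by eventually_elim (use N(1) in auto)
  qed
qed

lemma open_par_cylinder: "open (par_cylinder r x0 t0)"
proof -
  have "par_cylinder r x0 t0 = {p. norm (fst p - x0) < r} \<inter> {p. \<bar>snd p - t0\<bar> < r\<^sup>2}"
    by (auto simp: par_cylinder_def)
  moreover have "open \<dots>"
    by (intro open_Int open_Collect_less continuous_intros)
  ultimately show ?thesis by simp
qed

lemma kernel_const_nonneg: "0 \<le> kernel_const T s"
  by (simp add: kernel_const_def)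

lemma frac_heat_kernel_eq:
  fixes z :: "real ^ 'n"
  assumes "0 < h"
  shows "frac_heat_kernel s z h = kernel_const TYPE('n) s * heat_kernel s z h"
proof -
  have "(norm (z /\<^sub>R sqrt h))\<^sup>2 / 4 = (norm z)\<^sup>2 / (4 * h)"
    using assms by (simp only: norm_div_sqrt power_divide) simp
  moreover have "h powr (s - 1 - DIM(real ^ 'n) / 2) = 1 / h powr (real CARD('n) / 2 + 1 - s)"
    by (simp add: powr_minus_divide[symmetric] algebra_simps)
  ultimately show ?thesis
    using assms by (simp add: frac_heat_kernel_def self_similar_def gauss_profile_def del: norm_scaleR)
qed

text \<open>For almost every time the slice of \<open>F\<close> agrees almost everywhere with that
  of \<open>g\<close>, so \<open>integral_completion_cong_AE\<close> removes the Lebesgue integrals,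
  first in space and then in time; integrability of the potential then licenses Fubini. Attaching
  the kernel constant to the source lets the bounds for \<open>heat_kernel\<close> apply
  unchanged.\<close>

lemma frac_heat_potential_eq:
  fixes F g :: "(real ^ 'n) \<times> real \<Rightarrow> real"
  assumes s: "0 < s" "s < 1" and g: "bounded_source (\<lambda>p. kernel_const TYPE('n) s * g p) M"
    and g_meas [measurable]: "g \<in> borel_measurable borel" and Fg: "AE p in lborel. F p = g p"
  shows "frac_heat_potential s F (x, t) = potential (heat_kernel s) (\<lambda>p. kernel_const TYPE('n) s * g p) x t"
proof -
  let ?c = "kernel_const TYPE('n) s"
  interpret U: self_similar_kernel "gauss_profile :: real ^ 'n \<Rightarrow> real" "s - 1" "1024 * (DIM(real ^ 'n) / 2 + 2 - s)"
    using s by (intro self_similar_kernel_gauss_profile) auto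
  let ?q = "\<lambda>p. (?c * g p) *\<^sub>R heat_kernel s (x - fst p) (t - snd p)"
  have int: "integrable (lborel \<Otimes>\<^sub>M lborel) ?q"
    unfolding lborel_prod by (rule U.integrable_potential[OF g])
  then have int': "integrable (lborel \<Otimes>\<^sub>M lborel) (\<lambda>(y, \<tau>). ?q (y, \<tau>))"
    by (simp only: split_beta' prod.collapse)
  have J_meas: "(\<lambda>\<tau>. \<integral>y. ?q (y, \<tau>) \<partial>lborel) \<in> borel_measurable lborel"
    by (rule borel_measurable_integrable[OF lborel_pair.integrable_snd[OF int']])
  have "AE \<tau> in lborel. indicator {..<t} \<tau> *\<^sub>R (LINT y|lebesgue. F (y, \<tau>) * frac_heat_kernel s (x - y) (t - \<tau>))
      = (\<integral>y. ?q (y, \<tau>) \<partial>lborel)"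
    using AE_lborel_slices[OF Fg]
  proof eventually_elim
    case (elim \<tau>)
    show ?case
    proof (cases "\<tau> < t")
      case True
      have [measurable]: "(\<lambda>y. g (y, \<tau>)) \<in> borel_measurable borel"
      proof -
        have "(\<lambda>y. (y, \<tau>)) \<in> borel_measurable borel"
          by (intro borel_measurable_continuous_onI continuous_intros)
        then show ?thesis using g_meas by (rule measurable_compose)
      qed
      have "(LINT y|lebesgue. F (y, \<tau>) * frac_heat_kernel s (x - y) (t - \<tau>)) = (\<integral>y. ?q (y, \<tau>) \<partial>lborel)"
      proof (rule integral_completion_cong_AE)
        show "(\<lambda>y. ?q (y, \<tau>)) \<in> borel_measurable lborel" by simp
        show "AE y in lborel. F (y, \<tau>) * frac_heat_kernel s (x - y) (t - \<tau>) = ?q (y, \<tau>)"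
          using elim by eventually_elim (use True in \<open>simp add: frac_heat_kernel_eq\<close>)
      qed
      then show ?thesis using True by simp
    next
      \<comment> \<open>For \<open>\<tau> \<ge> t\<close> both sides are 0, the left by the
        indicator and the right by the causal convention in \<open>self_similar\<close>.\<close>
      case False
      then show ?thesis by (simp add: self_similar_def)
    qed
  qed
  then have "frac_heat_potential s F (x, t) = (\<integral>\<tau>. (\<integral>y. ?q (y, \<tau>) \<partial>lborel) \<partial>lborel)"
    unfolding frac_heat_potential_def set_lebesgue_integral_def prod.case
    by (rule integral_completion_cong_AE[OF J_meas])
  also have "\<dots> = (\<integral>p. ?q p \<partial>(lborel \<Otimes>\<^sub>M lborel))"
    using lborel_pair.integral_snd[OF int'] by (simp only: split_beta' prod.collapse)
  finally show ?thesis by (simp only: lborel_prod potential_def)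
qed

text \<open>The essential supremum bounds \<open>f\<close> almost everywhere, whereas
  \<open>bounded_source\<close> asks for a bound at every point. A Borel representative is therefore
  truncated at the levels \<open>- M\<close> and \<open>M\<close> and set to 0 off the cylinder,
  which alters it on a null set only.\<close>

lemma zero_extension_bounded_source:
  fixes f :: "(real ^ 'n) \<times> real \<Rightarrow> real" and M :: real
  assumes f: "f \<in> borel_measurable (lebesgue_on (par_cylinder 2 0 0))"
    and M: "0 \<le> M" and le: "Linfty_norm (par_cylinder 2 0 0) f = ennreal M"
  obtains g where "bounded_source g M" "AE p in lborel. zero_extension (par_cylinder 2 0 0) f p = g p"
proof -
  let ?Q = "par_cylinder 2 0 0 :: ((real ^ 'n) \<times> real) set"
  have Q [measurable]: "?Q \<in> sets borel" using open_par_cylinder by (rule borel_open)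
  have QL: "?Q \<in> sets lebesgue" using Q by simp
  let ?F = "zero_extension ?Q f"
  have "?F = (\<lambda>p. if p \<in> ?Q then f p else 0)" by (simp add: fun_eq_iff zero_extension_def)
  then have "?F \<in> borel_measurable lebesgue"
    using borel_measurable_if_I[OF f QL] by simp
  then obtain g' where g' [measurable]: "g' \<in> borel_measurable lborel" and ae1: "AE p in lborel. ?F p = g' p"
    using completion_ex_borel_measurable_real by blast
  have "AE p in lebesgue_on ?Q. ennreal \<bar>f p\<bar> \<le> ennreal M"
    using esssup_AE[of "\<lambda>p. ennreal \<bar>f p\<bar>" "lebesgue_on ?Q"] le by (simp add: Linfty_norm_def)
  then have "AE p in lebesgue. p \<in> ?Q \<longrightarrow> \<bar>f p\<bar> \<le> M"
    using QL M by (simp add: AE_restrict_space_iff)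
  then have ae2: "AE p in lborel. p \<in> ?Q \<longrightarrow> \<bar>f p\<bar> \<le> M" by (simp add: AE_completion_iff)
  define g where "g = (\<lambda>p. if p \<in> ?Q then max (- M) (min M (g' p)) else 0)"
  have g_meas: "g \<in> borel_measurable borel"
    using g' unfolding g_def measurable_lborel1 by measurable
  have "g p = 0" if "4 \<le> \<bar>snd p\<bar>" for p
    using that by (auto simp: g_def par_cylinder_def)
  moreover have "\<bar>g p\<bar> \<le> M" for p using M by (auto simp: g_def)
  ultimately have "bounded_source g M" using g_meas by (simp add: bounded_source_def del: split_paired_All)
  moreover have "AE p in lborel. ?F p = g p"
    using ae1 ae2 by eventually_elim (auto simp: g_def zero_extension_def)
  ultimately show ?thesis by (rule that)
qed

lemma bounded_source_cmult:
  assumes "0 \<le> c" "bounded_source g M"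
  shows "bounded_source (\<lambda>p. c * g p) (c * M)"
  using assms bounded_sourceD[OF assms(2)] unfolding bounded_source_def
  by (auto simp: abs_mult intro: mult_left_mono simp del: split_paired_All)

theorem theorem5:
  fixes s :: real
  assumes "0 < s" and "s < 1"
  shows "\<exists>C>0. \<forall>f :: (real ^ 'n) \<times> real \<Rightarrow> real.
           f \<in> borel_measurable (lebesgue_on (par_cylinder 2 0 0)) \<longrightarrow>
           bounded (f ` par_cylinder 2 0 0) \<longrightarrow>
           (let Q = par_cylinder 2 0 0;
                Q' = par_cylinder 1 0 0;
                w = frac_heat_potential s (zero_extension Q f)
            in (s \<noteq> 1/2 \<longrightarrow> par_holder_norm s Q' w \<le> ennreal C * Linfty_norm Q f) \<and>
               (s = 1/2 \<longrightarrow> log_lipschitz_holder_norm s Q' w \<le> ennreal C * Linfty_norm Q f))"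
proof -
  let ?Q = "par_cylinder 2 0 0 :: ((real ^ 'n) \<times> real) set"
  let ?Q' = "par_cylinder 1 0 0 :: ((real ^ 'n) \<times> real) set"
  let ?c = "kernel_const TYPE('n) s"
  \<comment> \<open>As \<open>s\<close> is fixed, one symbol for the relevant norm lets a single
    constant serve both conclusions.\<close>
  define N where "N \<Omega> w = (if s = 1/2 then log_lipschitz_holder_norm s \<Omega> w else par_holder_norm s \<Omega> w)"
    for \<Omega> :: "((real ^ 'n) \<times> real) set" and w
  have "\<exists>C\<ge>0. \<forall>(g :: (real ^ 'n) \<times> real \<Rightarrow> real) M w \<Omega>. bounded_source g M \<longrightarrow>
     (\<forall>x t. w (x, t) = potential (heat_kernel s) g x t) \<longrightarrow> (\<forall>p\<in>\<Omega>. norm (fst p) < 1 \<and> snd p < 1) \<longrightarrow>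
     N \<Omega> w \<le> ennreal (M * C)"
  proof (cases s "1/2 :: real" rule: linorder_cases)
    case less
    then show ?thesis unfolding N_def using par_holder_norm_potential_le_low[OF assms(1) less, where 'a="real ^ 'n"] by fastforce
  next
    case equal
    show ?thesis unfolding N_def equal if_P[OF refl] by (rule log_lipschitz_holder_norm_potential_le)
  next
    case greater
    then show ?thesis unfolding N_def using par_holder_norm_potential_le_high[OF greater assms(2), where 'a="real ^ 'n"] by fastforce
  qed
  then obtain C where C: "0 \<le> C" and bound: "\<And>(g :: (real ^ 'n) \<times> real \<Rightarrow> real) M w \<Omega>. bounded_source g M \<Longrightarrow>
     (\<And>x t. w (x, t) = potential (heat_kernel s) g x t) \<Longrightarrow> (\<And>p. p \<in> \<Omega> \<Longrightarrow> norm (fst p) < 1 \<and> snd p < 1) \<Longrightarrow>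
     N \<Omega> w \<le> ennreal (M * C)" by metis
  have "N ?Q' (frac_heat_potential s (zero_extension ?Q f)) \<le> ennreal (?c * C + 1) * Linfty_norm ?Q f"
    if f: "f \<in> borel_measurable (lebesgue_on ?Q)" and bdd: "bounded (f ` ?Q)" for f :: "(real ^ 'n) \<times> real \<Rightarrow> real"
  proof -
    obtain B where B: "\<And>p. p \<in> ?Q \<Longrightarrow> \<bar>f p\<bar> \<le> B"
      using bdd by (auto simp: bounded_iff)
    have "Linfty_norm ?Q f \<le> ennreal B"
      \<comment> \<open>\<open>B\<close> only shows that the essential supremum is finite; the
        estimates run with its real value \<open>M\<close>.\<close>
      unfolding Linfty_norm_def
      by (rule esssup_I) (use f B in \<open>auto intro!: AE_I2 ennreal_leI\<close>)
    then obtain M where M: "0 \<le> M" "Linfty_norm ?Q f = ennreal M"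
      by (cases "Linfty_norm ?Q f") (auto simp: top_unique)
    obtain g where g: "bounded_source g M" "AE p in lborel. zero_extension ?Q f p = g p"
      using zero_extension_bounded_source[OF f M] by blast
    have cg: "bounded_source (\<lambda>p. ?c * g p) (?c * M)"
      using kernel_const_nonneg g(1) by (rule bounded_source_cmult)
    have "N ?Q' (frac_heat_potential s (zero_extension ?Q f)) \<le> ennreal (?c * M * C)"
      by (rule bound[OF cg frac_heat_potential_eq[OF assms cg bounded_sourceD(3)[OF g(1)] g(2)]])
         (auto simp: par_cylinder_def)
    also have "?c * M * C \<le> (?c * C + 1) * M"
      using M by (simp add: algebra_simps)
    then have "ennreal (?c * M * C) \<le> ennreal ((?c * C + 1) * M)" by (rule ennreal_leI)
    also have "\<dots> = ennreal (?c * C + 1) * Linfty_norm ?Q f"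
      using M C kernel_const_nonneg[of "TYPE('n)" s] by (simp add: ennreal_mult)
    finally show ?thesis .
  qed
  moreover have "0 < ?c * C + 1"
    using C kernel_const_nonneg[of "TYPE('n)" s] by (simp add: add_nonneg_pos)
  ultimately show ?thesis
    unfolding Let_def by (intro exI[of _ "?c * C + 1"]) (auto simp: N_def split: if_splits)
qed

end
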